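(* Let $P(\lambda)=\sum_{i=0}^kP_i\,\phi_i^{(r)}(\lambda)$ be an $n\times n$ regular matrix polynomial (of grade $k$) expressed in the Chebyshev basis of the $r$th kind, where $r\in\{1,2\}$, and let $\lambda_0$ be an eigenvalue (finite or infinite) of $P(\lambda)$. Let $0\le\epsilon\le k-1$, $A\in\mathbb{C}^{(k-\epsilon)n\times\epsilon n}$, $B\in\mathbb{C}^{(k-1-\epsilon)n\times(\epsilon+1)n}$, and let $$C(\lambda)=\begin{bmatrix}M_\epsilon^C(\lambda)+AK_1^{(C,r)}(\lambda)+K_2^{(C,2)}(\lambda)^TB&K_2^{(C,2)}(\lambda)^T\\ K_1^{(C,r)}(\lambda)&0\end{bmatrix}.$$ Let $z$ and $w$ be, respectively, a right and a left eigenvector of $C(\lambda)$ associated with $\lambda_0$, regarded as block vectors with $k$ block entries $z(i),w(i)$ of length $n$. 1. Assume $\lambda_0$ is finite. Then $z(\epsilon+1)$ is a right eigenvector of $P(\lambda)$ with eigenvalue $\lambda_0$, and $w(k-\epsilon)$ is a left eigenvector of $P(\lambda)$ with eigenvalue $\lambda_0$. 2. Assume $\lambda_0$ is infinite. Then $z(1)$ is a right eigenvector of $P(\lambda)$ with eigenvalue at infinity, and $w(1)$ is a left eigenvector of $P(\lambda)$ with eigenvalue at infinity.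
   Context: Chebyshev setting (here $m=n$), $k\ge2$. $\phi_j^{(1)}$ and $\phi_j^{(2)}$ are the Chebyshev polynomials of the first and second kind: both satisfy $\phi_j(\lambda)=2\lambda\phi_{j-1}(\lambda)-\phi_{j-2}(\lambda)$ for $j\ge2$, with $\phi_0^{(1)}=\phi_0^{(2)}=1$, $\phi_1^{(1)}=\lambda$, $\phi_1^{(2)}=2\lambda$. For $0\le\epsilon\le k-1$ and $i,j\in\{1,2\}$, $K_1^{(C,i)}(\lambda)$ is the $\epsilon\times(\epsilon+1)$ block matrix with blocks of size $n\times n$ $$\begin{bmatrix}I&-2\lambda I&I\\&\ddots&\ddots&\ddots\\&&I&-2\lambda I&I\\&&&I&-\phi_1^{(i)}(\lambda)I\end{bmatrix},$$ and $K_2^{(C,j)}(\lambda)$ is the $(k-1-\epsilon)\times(k-\epsilon)$ block matrix of the same form with last entry $-\phi_1^{(j)}(\lambda)I_n$ (each block row but the last is $I,-2\lambda I,I$ starting on the diagonal; the last one is $I,-\phi_1I$). $K_1$ is empty if $\epsilon=0$, $K_2$ is empty if $\epsilon=k-1$. $M_\epsilon^C(\lambda)$ is the following $(k-\epsilon)\times(\epsilon+1)$ block pencil with $n\times n$ blocks. • If $1\le\epsilon\le k-2$: the first block column has entries $2\lambda P_k+P_{k-1}$ in row 1, $P_{k-2}-P_k$ in row 2, and $P_{k-t}$ in row $t$ for $3\le t\le k-\epsilon$; the second block column has entry $-P_{k+1-t}$ in row $t$ for $1\le t\le k-\epsilon-1$ and $P_{\epsilon-1}-P_{\epsilon+1}$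 in the last row $k-\epsilon$; the remaining block columns $3,\ldots,\epsilon+1$ are zero except in the last row, whose entries there are $P_{\epsilon-2},P_{\epsilon-3},\ldots,P_0$. • If $\epsilon=k-1$: $M_\epsilon^C=[2\lambda P_k+P_{k-1},\ P_{k-2}-P_k,\ P_{k-3},\ldots,P_1,P_0]$ (block row). • If $\epsilon=0$ and $r=1$: $M_\epsilon^C$ is $\frac12$ times the block column with blocks $2\lambda P_k+P_{k-1},\ P_{k-2}-2P_k,\ P_{k-3}-P_{k-1},\ldots,P_1-P_3,\ 2P_0-P_2$ (for $k=2$: $\frac12$ times the block column with blocks $2\lambda P_2+P_1$, $2P_0-2P_2$). • If $\epsilon=0$ and $r=2$: $M_\epsilon^C$ is the block column with blocks $2\lambda P_k+P_{k-1},\ P_{k-2}-P_k,\ P_{k-3},\ldots,P_1,P_0$. A square matrix polynomial is regular if its determinant is not identically zero. $\lambda_0\in\mathbb{C}$ is a finite eigenvalue of $P$ if $P(\lambda_0)$ is singular; a right (left) eigenvector is a nonzero $x$ with $P(\lambda_0)x=0$ (nonzero $y$ with $y^TP(\lambda_0)=0$, plain transpose). For $P$ of grade $k$, $\mathrm{rev}_kP(\lambda)=\lambda^kP(1/\lambda)$; $P$ has an infinite eigenvalue if $0$ is an eigenvalue of $\mathrm{rev}_kP$, and the associated right/left eigenvectors are those of $\mathrm{rev}_kP$ at $0$. For a pencil the same definitions are used with $k$ replaced by $1$. *)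

theory Defs
  imports Complex_Main "Jordan_Normal_Form.Determinant"
begin

text \<open>A matrix polynomial is a matrix over \<^typ>\<open>complex poly\<close>.  Block indices are 1-based throughout;
  entries of matrices and vectors are 0-based, as in the library.\<close>

fun chebyshev :: "nat \<Rightarrow> nat \<Rightarrow> complex poly" where
  "chebyshev r 0 = 1"
| "chebyshev r (Suc 0) = (if r = 1 then [:0, 1:] else [:0, 2:])"
| "chebyshev r (Suc (Suc j)) = [:0, 2:] * chebyshev r (Suc j) - chebyshev r j"

definition eval_mp :: "complex poly mat \<Rightarrow> complex \<Rightarrow> complex mat" where
  "eval_mp P c = map_mat (\<lambda>p. poly p c) P"

definition const_mp :: "complex mat \<Rightarrow> complex poly mat" where
  "const_mp A = map_mat (\<lambda>c. [:c:]) A"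

definition regular_mp :: "complex poly mat \<Rightarrow> bool" where
  "regular_mp P \<longleftrightarrow> dim_row P = dim_col P \<and> det P \<noteq> 0"

text \<open>Reversal with respect to the grade \<open>g\<close>, which may exceed the degree.\<close>

definition rev_poly :: "nat \<Rightarrow> complex poly \<Rightarrow> complex poly" where
  "rev_poly g p = (\<Sum>i\<le>g. monom (coeff p i) (g - i))"

lemma poly_rev_poly:
  assumes "degree p \<le> g" and "x \<noteq> 0"
  shows "poly (rev_poly g p) x = x ^ g * poly p (1 / x)"
proof -
  have "poly (rev_poly g p) x = (\<Sum>i\<le>g. coeff p i * x ^ (g - i))"
    by (simp add: rev_poly_def poly_sum poly_monom)
  also have "\<dots> = (\<Sum>i\<le>g. x ^ g * (coeff p i * (1 / x) ^ i))"
    using assms(2) by (intro sum.cong) (auto simp: power_diff power_one_over field_simps)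
  also have "\<dots> = x ^ g * poly p (1 / x)"
    by (subst (2) poly_as_sum_of_monoms'[OF assms(1), symmetric])
       (simp add: poly_sum poly_monom sum_distrib_left)
  finally show ?thesis .
qed

definition rev_mp :: "nat \<Rightarrow> complex poly mat \<Rightarrow> complex poly mat" where
  "rev_mp g P = map_mat (rev_poly g) P"

definition finite_eigenvalue :: "complex poly mat \<Rightarrow> complex \<Rightarrow> bool" where
  "finite_eigenvalue P c \<longleftrightarrow> dim_row P = dim_col P \<and> \<not> invertible_mat (eval_mp P c)"

definition finite_right_eigenvector :: "complex poly mat \<Rightarrow> complex \<Rightarrow> complex vec \<Rightarrow> bool" where
  "finite_right_eigenvector P c x \<longleftrightarrow>
     x \<in> carrier_vec (dim_col P) \<and> x \<noteq> 0\<^sub>v (dim_col P) \<and> eval_mp P c *\<^sub>v x = 0\<^sub>v (dim_row P)"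

text \<open>The equation \<open>y\<^sup>T P(c) = 0\<close> is written in transposed form; there is no conjugation.\<close>

definition finite_left_eigenvector :: "complex poly mat \<Rightarrow> complex \<Rightarrow> complex vec \<Rightarrow> bool" where
  "finite_left_eigenvector P c y \<longleftrightarrow>
     y \<in> carrier_vec (dim_row P) \<and> y \<noteq> 0\<^sub>v (dim_row P) \<and>
     transpose_mat (eval_mp P c) *\<^sub>v y = 0\<^sub>v (dim_col P)"

datatype eigval = Finite complex | Infinite

text \<open>The first argument \<open>g\<close> below is the grade.\<close>

fun mp_eigenvalue :: "nat \<Rightarrow> complex poly mat \<Rightarrow> eigval \<Rightarrow> bool" where
  "mp_eigenvalue g P (Finite c) = finite_eigenvalue P c"
| "mp_eigenvalue g P Infinite = finite_eigenvalue (rev_mp g P) 0"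

fun right_eigenvector :: "nat \<Rightarrow> complex poly mat \<Rightarrow> eigval \<Rightarrow> complex vec \<Rightarrow> bool" where
  "right_eigenvector g P (Finite c) x = finite_right_eigenvector P c x"
| "right_eigenvector g P Infinite x = finite_right_eigenvector (rev_mp g P) 0 x"

fun left_eigenvector :: "nat \<Rightarrow> complex poly mat \<Rightarrow> eigval \<Rightarrow> complex vec \<Rightarrow> bool" where
  "left_eigenvector g P (Finite c) y = finite_left_eigenvector P c y"
| "left_eigenvector g P Infinite y = finite_left_eigenvector (rev_mp g P) 0 y"

text \<open>The \<open>p \<times> q\<close> block matrix whose \<open>n \<times> n\<close> block in position \<open>(s, t)\<close> is \<open>F s t\<close>,
  and the \<open>i\<close>-th block of length \<open>n\<close> of a vector.\<close>

definition block_matrix :: "nat \<Rightarrow> nat \<Rightarrow> nat \<Rightarrow> (nat \<Rightarrow> nat \<Rightarrow> 'a mat) \<Rightarrow> 'a mat" where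
  "block_matrix n p q F =
     mat (p * n) (q * n) (\<lambda>(i, j). F (i div n + 1) (j div n + 1) $$ (i mod n, j mod n))"

definition vec_block :: "nat \<Rightarrow> 'a vec \<Rightarrow> nat \<Rightarrow> 'a vec" where
  "vec_block n v i = vec n (\<lambda>j. v $ ((i - 1) * n + j))"

definition cheb_mp :: "nat \<Rightarrow> nat \<Rightarrow> nat \<Rightarrow> (nat \<Rightarrow> complex mat) \<Rightarrow> complex poly mat" where
  "cheb_mp n k r P = mat n n (\<lambda>(a, b). \<Sum>i\<le>k. smult (P i $$ (a, b)) (chebyshev r i))"

text \<open>The \<open>d \<times> (d + 1)\<close> block pencil whose last block row ends in \<open>I, -\<phi>\<^sub>1 I\<close>, with \<open>\<phi>\<^sub>1\<close> of the
  \<open>i\<close>-th kind: \<open>K\<^sub>1\<close> is the case \<open>i = r\<close>, \<open>d = \<epsilon>\<close>, and \<open>K\<^sub>2\<close> the case \<open>i = 2\<close>, \<open>d = k - 1 - \<epsilon>\<close>.\<close>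

definition chebK :: "nat \<Rightarrow> nat \<Rightarrow> nat \<Rightarrow> complex poly mat" where
  "chebK n i d = block_matrix n d (d + 1) (\<lambda>s t.
     if t = s then 1\<^sub>m n
     else if t = s + 1 then (if s = d then - chebyshev i 1 else - [:0, 2:]) \<cdot>\<^sub>m 1\<^sub>m n
     else if t = s + 2 then 1\<^sub>m n
     else 0\<^sub>m n n)"

definition chebM ::
  "nat \<Rightarrow> nat \<Rightarrow> nat \<Rightarrow> nat \<Rightarrow> (nat \<Rightarrow> complex mat) \<Rightarrow> complex poly mat" where
  "chebM n k r \<epsilon> P =
    (let Q = (\<lambda>i. const_mp (P i));
         top = [:0, 2:] \<cdot>\<^sub>m Q k + Q (k - 1)
     in
     if \<epsilon> = 0 then
       (if r = 1 then
          [:1/2:] \<cdot>\<^sub>m block_matrix n k 1 (\<lambda>s t.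
            if s = 1 then top
            else if k = 2 then 2 \<cdot>\<^sub>m Q 0 - 2 \<cdot>\<^sub>m Q 2
            else if s = 2 then Q (k - 2) - 2 \<cdot>\<^sub>m Q k
            else if s = k then 2 \<cdot>\<^sub>m Q 0 - Q 2
            else Q (k - s) - Q (k - s + 2))
        else
          block_matrix n k 1 (\<lambda>s t.
            if s = 1 then top
            else if s = 2 then Q (k - 2) - Q k
            else Q (k - s)))
     else if \<epsilon> = k - 1 then
       block_matrix n 1 k (\<lambda>s t.
         if t = 1 then top
         else if t = 2 then Q (k - 2) - Q k
         else Q (k - t))
     else
       block_matrix n (k - \<epsilon>) (\<epsilon> + 1) (\<lambda>s t.
         if t = 1 then
           (if s = 1 then top else if s = 2 then Q (k - 2) - Q k else Q (k - s))
         else if t = 2 then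
           (if s < k - \<epsilon> then - Q (k + 1 - s) else Q (\<epsilon> - 1) - Q (\<epsilon> + 1))
         else if s = k - \<epsilon> then Q (\<epsilon> + 1 - t)
         else 0\<^sub>m n n))"

definition chebC ::
  "nat \<Rightarrow> nat \<Rightarrow> nat \<Rightarrow> nat \<Rightarrow> (nat \<Rightarrow> complex mat) \<Rightarrow> complex mat \<Rightarrow> complex mat
     \<Rightarrow> complex poly mat" where
  "chebC n k r \<epsilon> P A B =
    (let K1 = chebK n r \<epsilon>;
         K2T = transpose_mat (chebK n 2 (k - 1 - \<epsilon>))
     in four_block_mat
          (chebM n k r \<epsilon> P + const_mp A * K1 + K2T * const_mp B) K2T
          K1 (0\<^sub>m (\<epsilon> * n) ((k - 1 - \<epsilon>) * n)))"

end

theory Submission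
  imports Defs
begin

text \<open>For a finite \<open>\<lambda>\<^sub>0\<close> the kernel of \<open>K\<^sub>1(\<lambda>\<^sub>0)\<close> consists of the block vectors
  \<open>(\<phi>(\<epsilon>), \<dots>, \<phi>(0))\<^sup>T \<otimes> x\<close>, that of \<open>K\<^sub>2(\<lambda>\<^sub>0)\<close> of the same vectors with second-kind polynomials
  \<open>U\<close>, and both transposes are injective.  An eigenvector of \<open>C\<close> thus starts with such a block vector
  with \<open>x \<noteq> 0\<close>, and pairing \<open>M\<close> with the two kernels gives \<open>P(\<lambda>\<^sub>0)\<close>, because of
  \<open>\<phi>(e + 1 + i) = \<phi>(e + 1) U(i) - \<phi>(e) U(i - 1)\<close>.  At infinity evaluation is replaced by taking the
  leading coefficient: the kernels are spanned by the first block, and the pairing gives a nonzero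
  multiple of \<open>P\<^sub>k\<close>.  Left eigenvectors are covered by transposing \<open>C\<close>, which exchanges \<open>K\<^sub>1\<close>
  and \<open>K\<^sub>2\<close>.\<close>

section \<open>Block indices and block columns\<close>

lemma sum_blocks:
  fixes f :: "nat \<Rightarrow> 'a::comm_monoid_add"
  shows "(\<Sum>i<m * n. f i) = (\<Sum>s<m. \<Sum>q<n. f (s * n + q))"
proof -
  have "(\<Sum>q<n. f (s * n + q)) = sum f {s * n..<s * n + n}" for s
    using sum.shift_bounds_nat_ivl[of f 0 "s * n" n]
    by (simp add: atLeast0LessThan add.commute)
  then show ?thesis
    by (simp add: sum.nat_group)
qed

lemma block_index_less:
  fixes s m q n :: nat
  assumes "s < m" "q < n"
  shows "s * n + q < m * n"
proof -
  have "s * n + q < Suc s * n" using assms(2) by simp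
  also have "\<dots> \<le> m * n" using assms(1) by (intro mult_le_mono1) simp
  finally show ?thesis .
qed

lemma block_indexE:
  fixes i m n :: nat
  assumes "i < m * n"
  obtains s q where "i = s * n + q" "s < m" "q < n"
proof
  show "i = i div n * n + i mod n" by simp
  show "i div n < m" using assms by (simp add: less_mult_imp_div_less)
  show "i mod n < n" using assms by (cases n) auto
qed

text \<open>This is the Kronecker product of the column \<open>a 0, ..., a (m - 1)\<close> with the
  identity of size \<open>n\<close>. The kernels of both \<open>K\<close> pencils are images of such
  matrices, so statements about kernels become matrix products.\<close>

definition kron_col :: "nat \<Rightarrow> nat \<Rightarrow> (nat \<Rightarrow> 'a::zero) \<Rightarrow> 'a mat" where
  "kron_col n m a = mat (m * n) n (\<lambda>(i, j). if i mod n = j then a (i div n) else 0)"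

lemma kron_col_carrier [simp]: "kron_col n m a \<in> carrier_mat (m * n) n"
  by (simp add: kron_col_def)

lemma kron_col_dims [simp]: "dim_row (kron_col n m a) = m * n" "dim_col (kron_col n m a) = n"
  by (simp_all add: kron_col_def)

lemma kron_col_index:
  assumes "s < m" "q < n" "j < n"
  shows "kron_col n m a $$ (s * n + q, j) = (if q = j then a s else 0)"
  using assms by (simp add: kron_col_def block_index_less)

lemma kron_col_mult_vec:
  fixes x :: "'a::comm_semiring_1 vec"
  assumes "x \<in> carrier_vec n" "s < m" "q < n"
  shows "(kron_col n m a *\<^sub>v x) $ (s * n + q) = a s * x $ q"
proof -
  have "(kron_col n m a *\<^sub>v x) $ (s * n + q)
      = (\<Sum>j<n. kron_col n m a $$ (s * n + q, j) * x $ j)"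
    using assms by (simp add: scalar_prod_def block_index_less atLeast0LessThan)
  also have "\<dots> = (\<Sum>j<n. if j = q then a s * x $ q else 0)"
    using assms by (intro sum.cong) (auto simp: kron_col_index)
  finally show ?thesis using assms by simp
qed

lemma mult_kron_col_index:
  fixes X :: "'a::comm_semiring_1 mat"
  assumes "X \<in> carrier_mat l (m * n)" "i < l" "j < n"
  shows "(X * kron_col n m a) $$ (i, j) = (\<Sum>t<m. a t * X $$ (i, t * n + j))"
proof -
  have "(X * kron_col n m a) $$ (i, j)
      = (\<Sum>t<m. \<Sum>q<n. X $$ (i, t * n + q) * kron_col n m a $$ (t * n + q, j))"
    using assms
    by (simp add: scalar_prod_def atLeast0LessThan sum_blocks block_index_less)
  also have "\<dots> = (\<Sum>t<m. \<Sum>q<n. if q = j then a t * X $$ (i, t * n + j) else 0)"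
    using assms by (intro sum.cong) (auto simp: kron_col_index mult.commute)
  finally show ?thesis using assms by simp
qed

text \<open>Positions \<open>(i, j)\<close> inside a block do not mix: each entry of the product
  involves only the entries at that position in the blocks of \<open>X\<close>. This reduces the
  pairing of \<open>M\<close> with the kernels to a computation with scalar weights.\<close>

lemma kron_sandwich_index:
  fixes X :: "'a::comm_ring_1 mat"
  assumes X: "X \<in> carrier_mat (m * n) (m' * n)" and ij: "i < n" "j < n"
  shows "(transpose_mat (kron_col n m b) * X * kron_col n m' a) $$ (i, j)
    = (\<Sum>s<m. \<Sum>t<m'. b s * a t * X $$ (s * n + i, t * n + j))"
proof -
  have "(transpose_mat (kron_col n m b) * X) $$ (i, c) = (\<Sum>s<m. b s * X $$ (s * n + i, c))"
    if c: "c < m' * n" for c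
  proof -
    have XT: "transpose_mat X \<in> carrier_mat (m' * n) (m * n)"
      using X by simp
    \<comment> \<open>Transposing turns the multiplication from the left into the one from the right
      that \<open>mult_kron_col_index\<close> handles.\<close>
    have "transpose_mat (kron_col n m b) * X = transpose_mat (transpose_mat X * kron_col n m b)"
      using transpose_mult[OF XT kron_col_carrier] by simp
    then have "(transpose_mat (kron_col n m b) * X) $$ (i, c)
        = (transpose_mat X * kron_col n m b) $$ (c, i)"
      using X ij c by (simp del: index_mult_mat(1))
    also have "\<dots> = (\<Sum>s<m. b s * transpose_mat X $$ (c, s * n + i))"
      by (rule mult_kron_col_index[OF XT c ij(1)])
    finally show ?thesis
      using X ij c by (simp add: block_index_less)
  qed
  then have "(transpose_mat (kron_col n m b) * X * kron_col n m' a) $$ (i, j)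
      = (\<Sum>t<m'. a t * (\<Sum>s<m. b s * X $$ (s * n + i, t * n + j)))"
    using X ij by (subst mult_kron_col_index[where l = n])
      (auto intro!: sum.cong simp: block_index_less)
  also have "\<dots> = (\<Sum>t<m'. \<Sum>s<m. b s * a t * X $$ (s * n + i, t * n + j))"
    by (simp add: sum_distrib_left algebra_simps)
  finally show ?thesis by (subst sum.swap)
qed

section \<open>Linear algebra of the bordered matrix\<close>

lemma mult_mat_zero_vec:
  fixes X :: "'a::semiring_0 mat"
  assumes "X \<in> carrier_mat a b"
  shows "X *\<^sub>v 0\<^sub>v b = 0\<^sub>v a"
  using assms by (intro eq_vecI) auto

text \<open>With \<open>z\<close> split as \<open>(v, u)\<close>, the lower block row says
  \<open>K v = 0\<close>, which removes \<open>A\<close>; since \<open>L * N2 = 0\<close>,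
  multiplying the upper row by \<open>N2\<close> transposed removes \<open>B\<close> and
  \<open>u\<close>. The function \<open>e\<close> reads off the coordinate of a kernel vector with
  respect to \<open>N1\<close>. In this abstract form the lemma serves right eigenvectors directly
  and left ones after transposition.\<close>

lemma block_kernel_vector:
  fixes M A B K L :: "'a::field mat"
  assumes M: "M \<in> carrier_mat a b" and A: "A \<in> carrier_mat a q" and K: "K \<in> carrier_mat q b"
    and L: "L \<in> carrier_mat p a" and B: "B \<in> carrier_mat p b"
    and N1: "N1 \<in> carrier_mat b n" and N2: "N2 \<in> carrier_mat a n"
    and z: "z \<in> carrier_vec (b + p)" and nz: "z \<noteq> 0\<^sub>v (b + p)"
    and Cz: "four_block_mat (M + A * K + transpose_mat L * B) (transpose_mat L) K (0\<^sub>m q p) *\<^sub>v z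
               = 0\<^sub>v (a + q)"
    and e: "e (vec_first z b) \<in> carrier_vec n"
    and ker: "\<And>v. v \<in> carrier_vec b \<Longrightarrow> K *\<^sub>v v = 0\<^sub>v q \<Longrightarrow> v = N1 *\<^sub>v e v"
    and LN: "L * N2 = 0\<^sub>m p n"
    and inj: "\<And>u. u \<in> carrier_vec p \<Longrightarrow> transpose_mat L *\<^sub>v u = 0\<^sub>v a \<Longrightarrow> u = 0\<^sub>v p"
  shows "e (vec_first z b) \<noteq> 0\<^sub>v n"
    and "(transpose_mat N2 * M * N1) *\<^sub>v e (vec_first z b) = 0\<^sub>v n"
proof -
  define v u where "v = vec_first z b" and "u = vec_last z p"
  have v: "v \<in> carrier_vec b" and u: "u \<in> carrier_vec p"
    by (simp_all add: v_def u_def)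
  have zvu: "z = v @\<^sub>v u"
    using z by (simp add: v_def u_def)
  let ?T = "M + A * K + transpose_mat L * B"
  have LT: "transpose_mat L \<in> carrier_mat a p" using L by simp
  have T: "?T \<in> carrier_mat a b" using M A K L B by auto
  have zero_append: "0\<^sub>v (a + q) = 0\<^sub>v a @\<^sub>v (0\<^sub>v q :: 'a vec)"
    by (intro eq_vecI) auto
  have "(?T *\<^sub>v v + transpose_mat L *\<^sub>v u) @\<^sub>v (K *\<^sub>v v + 0\<^sub>m q p *\<^sub>v u) = 0\<^sub>v a @\<^sub>v 0\<^sub>v q"
    using Cz four_block_mat_mult_vec[OF T LT K zero_carrier_mat v u]
    unfolding zvu zero_append by simp
  then have top: "?T *\<^sub>v v + transpose_mat L *\<^sub>v u = 0\<^sub>v a"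
    and "K *\<^sub>v v + 0\<^sub>m q p *\<^sub>v u = 0\<^sub>v q"
    using T LT K v u by (subst (asm) append_vec_eq[of _ a]; auto)+
  moreover have "0\<^sub>m q p *\<^sub>v u = 0\<^sub>v q"
    using u by (intro eq_vecI) (auto simp: scalar_prod_def)
  ultimately have Kv: "K *\<^sub>v v = 0\<^sub>v q"
    using mult_mat_vec_carrier[OF K v] by simp
  have veq: "v = N1 *\<^sub>v e v"
    by (rule ker[OF v Kv])
  have ev: "e v \<in> carrier_vec n" using e by (simp add: v_def)
  have Tv: "?T *\<^sub>v v = M *\<^sub>v v + transpose_mat L *\<^sub>v (B *\<^sub>v v)"
  proof -
    have "?T *\<^sub>v v = (M + A * K) *\<^sub>v v + (transpose_mat L * B) *\<^sub>v v"
      using M A K LT B v by (intro add_mult_distrib_mat_vec[of _ a b]) auto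
    also have "(M + A * K) *\<^sub>v v = M *\<^sub>v v + A * K *\<^sub>v v"
      using M A K v by (intro add_mult_distrib_mat_vec[of _ a b]) auto
    also have "A * K *\<^sub>v v = 0\<^sub>v a"
      unfolding assoc_mult_mat_vec[OF A K v] Kv by (rule mult_mat_zero_vec[OF A])
    also have "(transpose_mat L * B) *\<^sub>v v = transpose_mat L *\<^sub>v (B *\<^sub>v v)"
      using LT B v by (rule assoc_mult_mat_vec)
    finally show ?thesis using M v by simp
  qed
  \<comment> \<open>A zero coordinate forces \<open>v = 0\<close>; the upper row then leaves
    \<open>L^T u = 0\<close>, so that \<open>u = 0\<close> by injectivity and \<open>z\<close> would
    vanish.\<close>
  show "e (vec_first z b) \<noteq> 0\<^sub>v n"
  proof
    assume "e (vec_first z b) = 0\<^sub>v n"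
    then have "N1 *\<^sub>v e v = 0\<^sub>v b"
      using mult_mat_zero_vec[OF N1] by (simp add: v_def)
    then have v0: "v = 0\<^sub>v b"
      by (rule trans[OF veq])
    then have "?T *\<^sub>v v = 0\<^sub>v a" using mult_mat_zero_vec[OF T] by simp
    then have "transpose_mat L *\<^sub>v u = 0\<^sub>v a"
      using top LT u by auto
    then have "u = 0\<^sub>v p" by (rule inj[OF u])
    then have "z = 0\<^sub>v b @\<^sub>v 0\<^sub>v p"
      using zvu v0 by simp
    also have "\<dots> = 0\<^sub>v (b + p)"
      by (intro eq_vecI) auto
    finally show False using nz by contradiction
  qed
  \<comment> \<open>The contributions of \<open>B\<close> and \<open>u\<close> both pass through
    \<open>L\<close> transposed, so one factor disposes of them together.\<close>
  have "M *\<^sub>v v + transpose_mat L *\<^sub>v (B *\<^sub>v v + u) = 0\<^sub>v a"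
    using top M B LT v u unfolding Tv
    by (simp add: mult_add_distrib_mat_vec[of _ a p] assoc_add_vec[of _ a])
  then have "transpose_mat N2 *\<^sub>v (M *\<^sub>v v + transpose_mat L *\<^sub>v (B *\<^sub>v v + u)) = 0\<^sub>v n"
    using N2 by (simp add: mult_mat_zero_vec)
  moreover have "transpose_mat N2 *\<^sub>v (transpose_mat L *\<^sub>v (B *\<^sub>v v + u)) = 0\<^sub>v n"
  proof -
    have "transpose_mat N2 * transpose_mat L = transpose_mat (0\<^sub>m p n)"
      using transpose_mult[OF L N2] LN by simp
    then show ?thesis
      using N2 LT B v u
      by (subst assoc_mult_mat_vec[of _ n a _ p, symmetric]) auto
  qed
  ultimately have "transpose_mat N2 *\<^sub>v (M *\<^sub>v v) = 0\<^sub>v n"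
    using N2 M LT B v u by (simp add: mult_add_distrib_mat_vec[of _ n a])
  then have "transpose_mat N2 *\<^sub>v (M *\<^sub>v (N1 *\<^sub>v e v)) = 0\<^sub>v n"
    by (subst veq[symmetric])
  then show "(transpose_mat N2 * M * N1) *\<^sub>v e (vec_first z b) = 0\<^sub>v n"
    using N2 M N1 ev unfolding v_def[symmetric]
    by (subst assoc_mult_mat_vec[of _ n b _ n], simp, simp, simp)
      (subst assoc_mult_mat_vec[of _ n a _ b], simp_all)
qed

section \<open>Finite and infinite eigenvalues as one functional\<close>

fun lam_val :: "nat \<Rightarrow> eigval \<Rightarrow> complex poly \<Rightarrow> complex" where
  "lam_val g (Finite c) p = poly p c"
| "lam_val g Infinite p = coeff p g"

lemma poly_rev_poly_0: "poly (rev_poly g p) 0 = coeff p g"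
proof -
  have "poly (rev_poly g p) 0 = (\<Sum>i\<le>g. if i = g then coeff p g else 0)"
    unfolding rev_poly_def poly_sum by (intro sum.cong) (auto simp: poly_monom)
  then show ?thesis by simp
qed

text \<open>At 0 the reversal only retains the coefficient of degree \<open>g\<close>. An
  eigenvector at infinity is thus a kernel vector of the matrix of these coefficients, which makes
  \<open>lam_val\<close> a common form of evaluation for both kinds of eigenvalues.\<close>

lemma eval_rev_mp_0: "eval_mp (rev_mp g P) 0 = map_mat (lam_val g Infinite) P"
  by (intro eq_matI) (simp_all add: eval_mp_def rev_mp_def poly_rev_poly_0)

lemma eval_mp_eq: "eval_mp P c = map_mat (lam_val g (Finite c)) P"
  by (intro eq_matI) (simp_all add: eval_mp_def)

lemma rev_mp_dims [simp]: "dim_row (rev_mp g P) = dim_row P" "dim_col (rev_mp g P) = dim_col P"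
  by (simp_all add: rev_mp_def)

lemma right_eigenvector_iff:
  "right_eigenvector g P lam x \<longleftrightarrow> x \<in> carrier_vec (dim_col P) \<and> x \<noteq> 0\<^sub>v (dim_col P)
     \<and> map_mat (lam_val g lam) P *\<^sub>v x = 0\<^sub>v (dim_row P)"
proof (cases lam)
  case (Finite c)
  then show ?thesis by (simp add: finite_right_eigenvector_def eval_mp_eq[of _ _ g])
qed (simp add: finite_right_eigenvector_def eval_rev_mp_0)

lemma left_eigenvector_iff:
  "left_eigenvector g P lam y \<longleftrightarrow> y \<in> carrier_vec (dim_row P) \<and> y \<noteq> 0\<^sub>v (dim_row P)
     \<and> transpose_mat (map_mat (lam_val g lam) P) *\<^sub>v y = 0\<^sub>v (dim_col P)"
proof (cases lam)
  case (Finite c)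
  then show ?thesis by (simp add: finite_left_eigenvector_def eval_mp_eq[of _ _ g])
qed (simp add: finite_left_eigenvector_def eval_rev_mp_0)

lemma lam_val_0 [simp]: "lam_val g lam 0 = 0"
  by (cases lam) simp_all

lemma lam_val_add: "lam_val g lam (p + q) = lam_val g lam p + lam_val g lam q"
  by (cases lam) simp_all

text \<open>Taking a coefficient is not multiplicative, so products are treated only when one factor
  is constant. This suffices for \<open>C\<close>, where the \<open>K\<close> pencils are multiplied
  by the constant matrices \<open>A\<close> and \<open>B\<close>.\<close>

lemma lam_val_const_mult: "lam_val g lam ([:c:] * p) = c * lam_val g lam p"
  by (cases lam) simp_all

lemma lam_val_mult_const: "lam_val g lam (p * [:c:]) = lam_val g lam p * c"
  by (cases lam) simp_all

lemma lam_val_sum: "lam_val g lam (sum f I) = (\<Sum>i\<in>I. lam_val g lam (f i))"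
  by (induction I rule: infinite_finite_induct) (simp_all add: lam_val_add)

lemma map_lam_val_add:
  assumes "X \<in> carrier_mat a b" "Y \<in> carrier_mat a b"
  shows "map_mat (lam_val g lam) (X + Y) = map_mat (lam_val g lam) X + map_mat (lam_val g lam) Y"
  using assms by (intro eq_matI) (auto simp: lam_val_add)

lemma map_lam_val_const_left:
  assumes "A \<in> carrier_mat a b" "X \<in> carrier_mat b c"
  shows "map_mat (lam_val g lam) (const_mp A * X) = A * map_mat (lam_val g lam) X"
  using assms
  by (intro eq_matI) (auto simp: const_mp_def scalar_prod_def lam_val_sum lam_val_const_mult
      simp del: mult_pCons_left)

lemma map_lam_val_const_right:
  assumes "X \<in> carrier_mat a b" "B \<in> carrier_mat b c"
  shows "map_mat (lam_val g lam) (X * const_mp B) = map_mat (lam_val g lam) X * B"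
  using assms
  by (intro eq_matI) (auto simp: const_mp_def scalar_prod_def lam_val_sum lam_val_mult_const
      simp del: mult_pCons_left mult_pCons_right)

lemma map_transpose: "map_mat f (transpose_mat X) = transpose_mat (map_mat f X)"
  by (intro eq_matI) simp_all

section \<open>Entries and kernels of the \<open>K\<close> pencils\<close>

lemma block_matrix_index:
  assumes "s < p" "t < q" "i < n" "j < n"
  shows "block_matrix n p q F $$ (s * n + i, t * n + j) = F (s + 1) (t + 1) $$ (i, j)"
  using assms by (simp add: block_matrix_def block_index_less)

lemma block_matrix_dims [simp]:
  "dim_row (block_matrix n p q F) = p * n" "dim_col (block_matrix n p q F) = q * n"
  by (simp_all add: block_matrix_def)

lemma lam_val_1 [simp]: "lam_val g (Finite c) 1 = 1" "g > 0 \<Longrightarrow> lam_val g Infinite 1 = 0"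
  by simp_all

lemma chebK_dims [simp]: "dim_row (chebK n i d) = d * n" "dim_col (chebK n i d) = (d + 1) * n"
  by (simp_all add: chebK_def block_matrix_def)

lemma chebM_carrier:
  assumes "\<epsilon> \<le> k - 1" "k \<ge> 2"
  shows "chebM n k r \<epsilon> P \<in> carrier_mat ((k - \<epsilon>) * n) ((\<epsilon> + 1) * n)"
proof -
  obtain l where "k = Suc (Suc l)" using assms(2) by (metis add_2_eq_Suc le_Suc_ex)
  then show ?thesis
    using assms by (intro carrier_matI) (simp_all add: chebM_def block_matrix_def Let_def)
qed

text \<open>The superdiagonal is the only band of \<open>chebK\<close> that involves the variable or
  the kind of polynomial. Rows count from 0 here, so the last one is
  \<open>Suc s = d\<close>.\<close>

definition chebK_super :: "nat \<Rightarrow> nat \<Rightarrow> nat \<Rightarrow> complex poly" where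
  "chebK_super i d s = (if Suc s = d then - chebyshev i 1 else - [:0, 2:])"

lemma chebK_index:
  assumes "s < d" "t \<le> d" "q < n" "q' < n"
  shows "chebK n i d $$ (s * n + q, t * n + q') =
    (if q = q' then (if t = s \<or> t = s + 2 then 1 else if t = s + 1 then chebK_super i d s else 0) else 0)"
  using assms by (auto simp: chebK_def block_matrix_index chebK_super_def)

text \<open>The index \<open>s + 2\<close> leaves the range exactly in the last row, which accounts
  for the conditional summand.\<close>

lemma sum_three_terms:
  fixes g :: "nat \<Rightarrow> 'a::comm_semiring_1"
  assumes "s < d"
  shows "(\<Sum>t<Suc d. (if t = s \<or> t = s + 2 then a else if t = s + 1 then b else 0) * g t)
    = a * g s + b * g (s + 1) + (if s + 2 \<le> d then a * g (s + 2) else 0)"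
proof -
  have "(\<Sum>t<Suc d. (if t = s \<or> t = s + 2 then a else if t = s + 1 then b else 0) * g t)
    = (\<Sum>t<Suc d. (if t = s then a * g s else 0) + (if t = s + 1 then b * g (s + 1) else 0)
         + (if t = s + 2 then a * g (s + 2) else 0))"
    by (intro sum.cong) auto
  then show ?thesis
    using assms by (simp add: sum.distrib del: sum.lessThan_Suc)
qed

lemma chebK_mult_vec:
  assumes v: "v \<in> carrier_vec ((d + 1) * n)" and s: "s < d" and q: "q < n"
  shows "(map_mat (lam_val 1 lam) (chebK n i d) *\<^sub>v v) $ (s * n + q) =
    lam_val 1 lam 1 * v $ (s * n + q) + lam_val 1 lam (chebK_super i d s) * v $ ((s + 1) * n + q)
    + (if s + 2 \<le> d then lam_val 1 lam 1 * v $ ((s + 2) * n + q) else 0)"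
proof -
  let ?K = "map_mat (lam_val 1 lam) (chebK n i d)"
  let ?k = "\<lambda>t. if t = s \<or> t = s + 2 then lam_val 1 lam 1
               else if t = s + 1 then lam_val 1 lam (chebK_super i d s) else 0"
  have sq: "s * n + q < d * n" using s q by (rule block_index_less)
  have ent: "?K $$ (s * n + q, t * n + q') = (if q' = q then ?k t else 0)"
    if "t < d + 1" "q' < n" for t q'
    using that sq q s block_index_less[OF that]
    by (subst index_map_mat) (auto simp: chebK_index)
  have "(?K *\<^sub>v v) $ (s * n + q) = (\<Sum>j<(d + 1) * n. ?K $$ (s * n + q, j) * v $ j)"
    using v sq by (simp add: scalar_prod_def atLeast0LessThan)
  also have "\<dots> = (\<Sum>t<d + 1. \<Sum>q'<n. if q' = q then ?k t * v $ (t * n + q) else 0)"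
    unfolding sum_blocks by (intro sum.cong refl, subst ent) auto
  also have "\<dots> = (\<Sum>t<Suc d. ?k t * v $ (t * n + q))"
    using q by simp
  also note sum_three_terms[OF s]
  finally show ?thesis .
qed

lemma chebK_transpose_mult_vec:
  assumes u: "u \<in> carrier_vec (d * n)" and t: "t \<le> d" and q: "q < n"
  shows "(transpose_mat (map_mat (lam_val 1 lam) (chebK n i d)) *\<^sub>v u) $ (t * n + q) =
    (\<Sum>s<d. (if t = s \<or> t = s + 2 then lam_val 1 lam 1
             else if t = s + 1 then lam_val 1 lam (chebK_super i d s) else 0) * u $ (s * n + q))"
proof -
  let ?K = "map_mat (lam_val 1 lam) (chebK n i d)"
  let ?k = "\<lambda>s. if t = s \<or> t = s + 2 then lam_val 1 lam 1
               else if t = s + 1 then lam_val 1 lam (chebK_super i d s) else 0"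
  have tq: "t * n + q < (d + 1) * n" using t q by (intro block_index_less) auto
  have ent: "?K $$ (s * n + q', t * n + q) = (if q' = q then ?k s else 0)"
    if "s < d" "q' < n" for s q'
    using that tq q t block_index_less[OF that]
    by (subst index_map_mat) (auto simp: chebK_index)
  have "(transpose_mat ?K *\<^sub>v u) $ (t * n + q) = (\<Sum>j<d * n. ?K $$ (j, t * n + q) * u $ j)"
    using u tq by (simp add: scalar_prod_def atLeast0LessThan)
  also have "\<dots> = (\<Sum>s<d. \<Sum>q'<n. if q' = q then ?k s * u $ (s * n + q) else 0)"
    unfolding sum_blocks by (intro sum.cong refl, subst ent) auto
  finally show ?thesis using q by simp
qed

text \<open>The kernel of \<open>chebK n i d\<close> at \<open>lam\<close> is spanned by the block vectors with \<open>t\<close>-th block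
  \<open>cheb_weight lam i d t \<cdot> x\<close>; \<open>cheb_pivot lam d\<close> is a block of weight 1.  Here blocks count from 0.\<close>

fun cheb_weight :: "eigval \<Rightarrow> nat \<Rightarrow> nat \<Rightarrow> nat \<Rightarrow> complex" where
  "cheb_weight (Finite c) i d t = poly (chebyshev i (d - t)) c"
| "cheb_weight Infinite i d t = (if t = 0 then 1 else 0)"

fun cheb_pivot :: "eigval \<Rightarrow> nat \<Rightarrow> nat" where
  "cheb_pivot (Finite c) d = d"
| "cheb_pivot Infinite d = 0"

text \<open>The entry is \<open>- lambda\<close> or \<open>- 2 lambda\<close>. At infinity the
  identity blocks have coefficient 0 in degree 1, so this nonzero number is all that remains of a
  row.\<close>

lemma chebK_super_Infinite_nonzero: "lam_val 1 Infinite (chebK_super i d s) \<noteq> 0"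
  by (simp add: chebK_super_def)

lemma cheb_pivot_le: "cheb_pivot lam d \<le> d"
  by (cases lam) auto

text \<open>At a finite point the rows are the Chebyshev recurrence read upwards: the last row gives
  block \<open>d - 1\<close> from block \<open>d\<close>, and each row above yields its diagonal
  block from the two following ones. At infinity row \<open>s\<close> reduces to a nonzero multiple
  of block \<open>s + 1\<close>, so only block 0 is free.\<close>

lemma chebK_kernel_pointwise:
  assumes v: "v \<in> carrier_vec ((d + 1) * n)"
    and Kv: "map_mat (lam_val 1 lam) (chebK n i d) *\<^sub>v v = 0\<^sub>v (d * n)"
    and t: "t \<le> d" and q: "q < n"
  shows "v $ (t * n + q) = cheb_weight lam i d t * v $ (cheb_pivot lam d * n + q)"
proof -
  have row: "lam_val 1 lam 1 * v $ (s * n + q) + lam_val 1 lam (chebK_super i d s) * v $ ((s + 1) * n + q)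
    + (if s + 2 \<le> d then lam_val 1 lam 1 * v $ ((s + 2) * n + q) else 0) = 0" if "s < d" for s
    using chebK_mult_vec[OF v that q, of lam i] block_index_less[OF that q]
    by (simp add: Kv del: One_nat_def)
  show ?thesis
  proof (cases lam)
    case Infinite
    show ?thesis
    proof (cases t)
      case (Suc s)
      then have "v $ ((s + 1) * n + q) = 0"
        using t row[of s] chebK_super_Infinite_nonzero[of i d s] Infinite
        by (simp del: lam_val.simps One_nat_def split: if_splits)
      then show ?thesis
        by (simp add: Infinite Suc)
    qed (simp add: Infinite)
  next
    case (Finite c)
    \<comment> \<open>The induction runs over the distance \<open>m\<close> from the last block,
      because this distance is the index of the Chebyshev polynomial.\<close>
    have "m \<le> d \<Longrightarrow> v $ ((d - m) * n + q) = poly (chebyshev i m) c * v $ (d * n + q)" for m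
    proof (induction m rule: induct_nat_012)
      case 1
      then show ?case using row[of "d - 1"] by (simp add: Finite chebK_super_def)
    next
      case (ge2 m)
      define s where "s = d - Suc (Suc m)"
      have s: "s < d" "Suc s \<noteq> d" "s + 2 \<le> d" "d - Suc m = s + 1" "d - m = s + 2"
        using ge2.prems by (auto simp: s_def)
      have "v $ (s * n + q) - 2 * c * v $ ((s + 1) * n + q) + v $ ((s + 2) * n + q) = 0"
        using row[OF s(1)] s(2,3) by (simp add: Finite chebK_super_def algebra_simps del: One_nat_def)
      moreover have "v $ ((s + 1) * n + q) = poly (chebyshev i (Suc m)) c * v $ (d * n + q)"
        using ge2 s by simp
      moreover have "v $ ((s + 2) * n + q) = poly (chebyshev i m) c * v $ (d * n + q)"
        using ge2 s by simp
      ultimately show ?case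
        by (simp add: s_def[symmetric] algebra_simps)
    qed simp
    from this[of "d - t"] show ?thesis using t by (simp add: Finite)
  qed
qed

text \<open>\<open>cheb_pivot\<close> counts from 0 and \<open>vec_block\<close> from 1, hence the
  shift by one.\<close>

lemma chebK_kernel:
  assumes v: "v \<in> carrier_vec ((d + 1) * n)"
    and Kv: "map_mat (lam_val 1 lam) (chebK n i d) *\<^sub>v v = 0\<^sub>v (d * n)"
  shows "v = kron_col n (d + 1) (cheb_weight lam i d) *\<^sub>v vec_block n v (cheb_pivot lam d + 1)"
proof (rule eq_vecI)
  fix j assume "j < dim_vec (kron_col n (d + 1) (cheb_weight lam i d) *\<^sub>v vec_block n v (cheb_pivot lam d + 1))"
  then have "j < (d + 1) * n" by simp
  then obtain t q where j: "j = t * n + q" "t < d + 1" "q < n"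
    by (rule block_indexE)
  then show "v $ j = (kron_col n (d + 1) (cheb_weight lam i d) *\<^sub>v vec_block n v (cheb_pivot lam d + 1)) $ j"
    using chebK_kernel_pointwise[OF v Kv, of t q]
    by (subst j, subst kron_col_mult_vec) (auto simp: vec_block_def)
qed (use v in auto)

text \<open>This converse of \<open>chebK_kernel\<close> supplies the hypothesis
  \<open>L * N2 = 0\<close> of \<open>block_kernel_vector\<close>.\<close>

lemma chebK_mult_kron_col:
  "map_mat (lam_val 1 lam) (chebK n i d) * kron_col n (d + 1) (cheb_weight lam i d) = 0\<^sub>m (d * n) n"
proof (rule eq_matI)
  let ?K = "map_mat (lam_val 1 lam) (chebK n i d)"
  let ?N = "kron_col n (d + 1) (cheb_weight lam i d)"
  fix l j assume "l < dim_row (0\<^sub>m (d * n) n :: complex mat)" "j < dim_col (0\<^sub>m (d * n) n :: complex mat)"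
  then have "l < d * n" and j: "j < n" by simp_all
  then obtain s q where l: "l = s * n + q" and s: "s < d" and q: "q < n"
    by (elim block_indexE)
  \<comment> \<open>The row equation for the weights alone. At a finite point it is the recurrence
    at index \<open>d - s\<close>, or in the last row \<open>phi_1 - phi_1 * phi_0 = 0\<close>. At
    infinity the weights at \<open>s + 1\<close> and \<open>s + 2\<close> vanish and the weight at
    \<open>s\<close> is multiplied by 0.\<close>
  have w: "lam_val 1 lam 1 * cheb_weight lam i d s
      + lam_val 1 lam (chebK_super i d s) * cheb_weight lam i d (s + 1)
      + (if s + 2 \<le> d then lam_val 1 lam 1 * cheb_weight lam i d (s + 2) else 0) = 0"
  proof (cases lam)
    case (Finite c)
    show ?thesis
    proof (cases "s + 2 \<le> d")
      case True
      then have "d - s = Suc (Suc (d - (s + 2)))" "d - (s + 1) = Suc (d - (s + 2))" by auto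
      then show ?thesis using True by (simp add: Finite chebK_super_def)
    next
      case False
      then have "d = Suc s" using s by simp
      then show ?thesis by (simp add: Finite chebK_super_def)
    qed
  qed simp
  have N: "col ?N j $ (t * n + q) = (if q = j then cheb_weight lam i d t else 0)" if "t \<le> d" for t
    using that j q block_index_less[of t "d + 1" q n] by (simp add: kron_col_index)
  have colN: "col ?N j \<in> carrier_vec ((d + 1) * n)"
    by (rule carrier_vecI) (simp del: One_nat_def)
  have "(?K * ?N) $$ (l, j) = (?K *\<^sub>v col ?N j) $ (s * n + q)"
    using \<open>l < d * n\<close> j unfolding l
    by (subst index_mult_mat(1)) (simp_all del: index_col)
  also have "\<dots> = lam_val 1 lam 1 * col ?N j $ (s * n + q)
      + lam_val 1 lam (chebK_super i d s) * col ?N j $ ((s + 1) * n + q)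
      + (if s + 2 \<le> d then lam_val 1 lam 1 * col ?N j $ ((s + 2) * n + q) else 0)"
    by (rule chebK_mult_vec[OF colN s q])
  also have "\<dots> = (if q = j then lam_val 1 lam 1 * cheb_weight lam i d s
      + lam_val 1 lam (chebK_super i d s) * cheb_weight lam i d (s + 1)
      + (if s + 2 \<le> d then lam_val 1 lam 1 * cheb_weight lam i d (s + 2) else 0) else 0)"
  proof (cases "s + 2 \<le> d")
    case True
    then have "s \<le> d" "s + 1 \<le> d" by auto
    then show ?thesis
      unfolding N[OF True] N[OF \<open>s \<le> d\<close>] N[OF \<open>s + 1 \<le> d\<close>] by simp
  next
    case False
    have "s \<le> d" "s + 1 \<le> d" using s by auto
    then show ?thesis
      unfolding if_not_P[OF False] N[OF \<open>s \<le> d\<close>] N[OF \<open>s + 1 \<le> d\<close>] by simp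
  qed
  also have "\<dots> = 0"
    unfolding w by simp
  finally show "(?K * ?N) $$ (l, j) = 0\<^sub>m (d * n) n $$ (l, j)"
    using \<open>l < d * n\<close> j by simp
qed simp_all

text \<open>At a finite point the first \<open>d\<close> block columns form a unit upper triangular
  matrix, so the blocks of \<open>u\<close> vanish one after another. At infinity block column
  \<open>s + 1\<close> holds a single nonzero multiple of the identity, in row
  \<open>s\<close>.\<close>

lemma chebK_transpose_injective:
  assumes u: "u \<in> carrier_vec (d * n)"
    and Ku: "transpose_mat (map_mat (lam_val 1 lam) (chebK n i d)) *\<^sub>v u = 0\<^sub>v ((d + 1) * n)"
  shows "u = 0\<^sub>v (d * n)"
proof (rule eq_vecI)
  fix j assume "j < dim_vec (0\<^sub>v (d * n) :: complex vec)"
  then have "j < d * n" by simp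
  then obtain s q where j: "j = s * n + q" and s: "s < d" and q: "q < n"
    by (elim block_indexE)
  have col: "(\<Sum>s<d. (if t = s \<or> t = s + 2 then lam_val 1 lam 1
             else if t = s + 1 then lam_val 1 lam (chebK_super i d s) else 0) * u $ (s * n + q)) = 0"
    if "t \<le> d" for t
    using chebK_transpose_mult_vec[OF u that q, of lam i] block_index_less[of t "d + 1" q n] that q
    by (simp add: Ku del: One_nat_def)
  have "u $ (s * n + q) = 0"
  proof (cases lam)
    case Infinite
    have "(\<Sum>s'<d. if s' = s then lam_val 1 lam (chebK_super i d s) * u $ (s * n + q) else 0) = 0"
    proof (rule trans[OF sum.cong[OF refl] col[of "Suc s"]])
      fix s' assume "s' \<in> {..<d}"
      show "(if s' = s then lam_val 1 lam (chebK_super i d s) * u $ (s * n + q) else 0)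
        = (if Suc s = s' \<or> Suc s = s' + 2 then lam_val 1 lam 1
           else if Suc s = s' + 1 then lam_val 1 lam (chebK_super i d s') else 0) * u $ (s' * n + q)"
        unfolding Infinite by (simp del: lam_val.simps One_nat_def)
    qed (use s in simp)
    then show ?thesis
      using s chebK_super_Infinite_nonzero[of i d s] Infinite by simp
  next
    case (Finite c)
    show ?thesis using s
    proof (induction s rule: less_induct)
      case (less s)
      \<comment> \<open>Column \<open>s\<close> meets at most the rows \<open>s\<close>,
        \<open>s - 1\<close> and \<open>s - 2\<close>; the induction hypothesis removes the last
        two.\<close>
      have "(\<Sum>s'<d. if s' = s then u $ (s * n + q) else 0) = 0"
      proof (rule trans[OF sum.cong[OF refl] col[of s]])
        fix s' assume "s' \<in> {..<d}"
        then show "(if s' = s then u $ (s * n + q) else 0)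
          = (if s = s' \<or> s = s' + 2 then lam_val 1 lam 1
             else if s = s' + 1 then lam_val 1 lam (chebK_super i d s') else 0) * u $ (s' * n + q)"
          using less.IH[of s'] Finite by (cases s' s rule: linorder_cases) simp_all
      qed (use less.prems in simp)
      then show ?case using less.prems by simp
    qed
  qed
  then show "u $ j = 0\<^sub>v (d * n) $ j"
    using j \<open>j < d * n\<close> by simp
qed (use u in simp)

section \<open>Chebyshev identities\<close>

lemma coeff_chebyshev_above: "i < j \<Longrightarrow> coeff (chebyshev r i) j = 0"
proof (induction r i arbitrary: j rule: chebyshev.induct)
  case (2 r)
  then show ?case by (cases j) (auto simp: coeff_pCons split: nat.splits)
next
  case (3 r i)
  then show ?case by (cases j) auto
qed simp

text \<open>The recurrence doubles the top coefficient, as the subtracted polynomial has too low a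
  degree to contribute. This coefficient becomes a denominator in the pairing at infinity.\<close>

lemma coeff_chebyshev_top: "coeff (chebyshev r i) i \<noteq> 0"
proof (induction r i rule: chebyshev.induct)
  case (3 r i)
  then show ?case by (simp add: coeff_chebyshev_above)
qed auto

lemma sum_lessThan_add:
  fixes f :: "nat \<Rightarrow> 'a::comm_monoid_add"
  shows "(\<Sum>i<a + b. f i) = (\<Sum>i<a. f i) + (\<Sum>i<b. f (a + i))"
  by (induction b) (simp_all add: add.assoc)

text \<open>As functions of \<open>i\<close> both sides obey the same three-term recurrence, and
  they agree for \<open>i = 0\<close> and \<open>i = 1\<close>. The identity expresses later
  polynomials of either kind through two consecutive ones, with second-kind coefficients; this
  explains why \<open>K_2\<close> is of the second kind for both values of \<open>r\<close>.\<close>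

lemma chebyshev_second_shift:
  "chebyshev r (Suc e + Suc i)
     = chebyshev r (Suc e) * chebyshev 2 (Suc i) - chebyshev r e * chebyshev 2 i"
proof (induction i rule: induct_nat_012)
  case (ge2 i)
  have "chebyshev r (Suc e + Suc (Suc (Suc i)))
      = [:0, 2:] * chebyshev r (Suc e + Suc (Suc i)) - chebyshev r (Suc e + Suc i)"
    by (simp add: numeral_2_eq_2)
  then show ?case
    unfolding ge2 by (simp add: algebra_simps del: mult_pCons_left mult_pCons_right)
qed (simp_all add: algebra_simps del: mult_pCons_left mult_pCons_right)

text \<open>Again a comparison of recurrences and of the cases \<open>i = 0\<close> and
  \<open>i = 1\<close>. For \<open>\<epsilon> = 0\<close> the weights are all of the second kind, so
  a polynomial in the first-kind basis has to be rewritten this way; the factor 2 is the origin of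
  the \<open>1/2\<close> in \<open>chebM\<close>.\<close>

lemma chebyshev_first_second:
  "2 * chebyshev 1 (Suc (Suc i)) = chebyshev 2 (Suc (Suc i)) - chebyshev 2 i"
proof (induction i rule: induct_nat_012)
  case (ge2 i)
  have "2 * chebyshev 1 (Suc (Suc (Suc (Suc i))))
     = [:0, 2:] * (2 * chebyshev 1 (Suc (Suc (Suc i)))) - 2 * chebyshev 1 (Suc (Suc i))"
    by (simp add: algebra_simps del: mult_pCons_left mult_pCons_right)
  then show ?case
    unfolding ge2 by (simp add: algebra_simps del: mult_pCons_left mult_pCons_right)
qed (simp_all add: algebra_simps numeral_poly)

text \<open>The scalar pattern of \<open>chebM\<close>: its \<open>n \<times> n\<close> blocks are linear in the coefficient
  matrices, so each position inside a block carries this pattern with scalar coefficients.\<close>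

definition chebM_scalar :: "nat \<Rightarrow> nat \<Rightarrow> nat \<Rightarrow> (nat \<Rightarrow> complex) \<Rightarrow> nat \<Rightarrow> nat \<Rightarrow> complex poly" where
  "chebM_scalar k r \<epsilon> p s t =
    (let top = [:0, 2:] * [:p k:] + [:p (k - 1):] in
     if \<epsilon> = 0 then
       (if r = 1 then
          [:1/2:] * (if s = 1 then top
            else if k = 2 then 2 * [:p 0:] - 2 * [:p 2:]
            else if s = 2 then [:p (k - 2):] - 2 * [:p k:]
            else if s = k then 2 * [:p 0:] - [:p 2:]
            else [:p (k - s):] - [:p (k - s + 2):])
        else if s = 1 then top
        else if s = 2 then [:p (k - 2):] - [:p k:]
        else [:p (k - s):])
     else if \<epsilon> = k - 1 then
       (if t = 1 then top
        else if t = 2 then [:p (k - 2):] - [:p k:]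
        else [:p (k - t):])
     else if t = 1 then
       (if s = 1 then top else if s = 2 then [:p (k - 2):] - [:p k:] else [:p (k - s):])
     else if t = 2 then
       (if s < k - \<epsilon> then - [:p (k + 1 - s):] else [:p (\<epsilon> - 1):] - [:p (\<epsilon> + 1):])
     else if s = k - \<epsilon> then [:p (\<epsilon> + 1 - t):]
     else 0)"

section \<open>Pairing \<open>M\<close> with the two kernels\<close>

lemma chebM_index:
  assumes k: "k \<ge> 2" and \<epsilon>: "\<epsilon> \<le> k - 1"
    and P: "\<And>i. i \<le> k \<Longrightarrow> P i \<in> carrier_mat n n"
    and st: "s < k - \<epsilon>" "t < \<epsilon> + 1" and ij: "i < n" "j < n"
  shows "chebM n k r \<epsilon> P $$ (s * n + i, t * n + j)
    = chebM_scalar k r \<epsilon> (\<lambda>l. P l $$ (i, j)) (s + 1) (t + 1)"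
proof -
  have Q: "dim_row (const_mp (P l)) = n" "dim_col (const_mp (P l)) = n"
    "const_mp (P l) $$ (i, j) = [:P l $$ (i, j):]" if "l \<le> k" for l
    using P[OF that] ij by (auto simp: const_mp_def)
  have top: "([:0, 2:] \<cdot>\<^sub>m const_mp (P k) + const_mp (P (k - 1))) $$ (i, j)
      = [:0, 2:] * [:P k $$ (i, j):] + [:P (k - 1) $$ (i, j):]"
    using ij by (simp add: Q del: mult_pCons_left mult_pCons_right)
  consider "\<epsilon> = 0" | "\<epsilon> \<noteq> 0" "\<epsilon> = k - 1" | "\<epsilon> \<noteq> 0" "\<epsilon> \<noteq> k - 1" by blast
  then show ?thesis
  proof cases
    case 1
    then have t: "t = 0" and s: "s < k" using st by auto
    have lt: "s * n + i < k * n" "0 * n + j < 1 * n"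
      using s ij by (auto intro: block_index_less)
    show ?thesis
      unfolding chebM_def chebM_scalar_def Let_def 1 t if_P[OF refl]
      using s ij lt k top
      by (auto simp: block_matrix_index[of s k 0 1, simplified] Q
          simp del: mult_pCons_left mult_pCons_right)
  next
    case 2
    then have s: "s = 0" and t: "t < k" using st k by auto
    have "chebM n k r \<epsilon> P $$ (s * n + i, t * n + j) =
      (if t + 1 = 1 then [:0, 2:] \<cdot>\<^sub>m const_mp (P k) + const_mp (P (k - 1))
       else if t + 1 = 2 then const_mp (P (k - 2)) - const_mp (P k)
       else const_mp (P (k - (t + 1)))) $$ (i, j)"
      unfolding chebM_def Let_def if_not_P[OF 2(1)] if_P[OF 2(2)]
      by (rule block_matrix_index) (use s t ij in auto)
    then show ?thesis
      using 2 ij k top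
      by (auto simp: chebM_scalar_def Let_def Q simp del: mult_pCons_left mult_pCons_right)
  next
    case 3
    then show ?thesis
      using st ij k \<epsilon> top
      by (auto simp: chebM_def chebM_scalar_def Let_def block_matrix_index Q
          simp del: mult_pCons_left mult_pCons_right)
  qed
qed

text \<open>The weights are the Chebyshev values from the kernels of \<open>K_2\<close> (rows) and
  \<open>K_1\<close> (columns). In every layout the factor \<open>2 lambda\<close> at
  \<open>p k\<close> is absorbed by the three-term recurrence. The rest is immediate for a single
  block row or a single column in the second kind; a single column in the first kind needs
  \<open>chebyshev_first_second\<close>, and the general layout needs
  \<open>chebyshev_second_shift\<close>.\<close>

lemma chebM_scalar_sum:
  assumes k: "k \<ge> 2" and r: "r \<in> {1, 2}" and \<epsilon>: "\<epsilon> \<le> k - 1"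
  shows "(\<Sum>s<k - \<epsilon>. \<Sum>t<\<epsilon> + 1. poly (chebyshev 2 (k - 1 - \<epsilon> - s)) c * poly (chebyshev r (\<epsilon> - t)) c
            * poly (chebM_scalar k r \<epsilon> p (s + 1) (t + 1)) c)
    = (\<Sum>i\<le>k. p i * poly (chebyshev r i) c)"
proof -
  define u g where "u i = poly (chebyshev 2 i) c" and "g i = poly (chebyshev r i) c" for i
  let ?m = "\<lambda>s t. poly (chebM_scalar k r \<epsilon> p (s + 1) (t + 1)) c"
  have u: "u 0 = 1" "u (Suc 0) = 2 * c" "\<And>i. u (Suc (Suc i)) = 2 * c * u (Suc i) - u i"
    and g: "g 0 = 1" "\<And>i. g (Suc (Suc i)) = 2 * c * g (Suc i) - g i"
    by (simp_all add: u_def g_def algebra_simps)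
  have shift: "g (Suc e + Suc i) = g (Suc e) * u (Suc i) - g e * u i" for e i
    using arg_cong[OF chebyshev_second_shift[of r e i], of "\<lambda>q. poly q c"]
    unfolding u_def g_def by (simp del: chebyshev.simps(3) add_Suc add_Suc_right)
  \<comment> \<open>The blocks of \<open>M\<close> list the coefficients in decreasing order of
    index, so the sums have to be reversed.\<close>
  have rev: "(\<Sum>i<l. f (l - Suc i)) = (\<Sum>i<l. f i)" for l and f :: "nat \<Rightarrow> complex"
    by (rule sum.nat_diff_reindex)
  consider (first) "\<epsilon> = 0" "r = 1" | (second) "\<epsilon> = 0" "r = 2" | (row) "\<epsilon> \<noteq> 0" "\<epsilon> = k - 1"
    | (mid) "\<epsilon> \<noteq> 0" "\<epsilon> \<noteq> k - 1"
    using r by blast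
  then have "(\<Sum>s<k - \<epsilon>. \<Sum>t<\<epsilon> + 1. u (k - 1 - \<epsilon> - s) * g (\<epsilon> - t) * ?m s t) = (\<Sum>i<Suc k. p i * g i)"
  proof cases
    case row
    \<comment> \<open>Writing \<open>k\<close> as \<open>Suc (Suc l)\<close> separates the two
      exceptional leading blocks from the \<open>l\<close> regular ones.\<close>
    define l where "l = k - 2"
    have kl: "k = Suc (Suc l)" and \<epsilon>l: "\<epsilon> = Suc l" using k row by (auto simp: l_def)
    have "(\<Sum>t<l. g (l - Suc t) * p (l - Suc t)) = (\<Sum>i<l. g i * p i)"
      by (rule rev[of "\<lambda>i. g i * p i"])
    moreover have "?m 0 0 = 2 * c * p k + p (Suc l)" "?m 0 1 = p l - p k"
      "\<And>t. ?m 0 (t + 2) = p (l - Suc t)"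
      by (simp_all add: chebM_scalar_def Let_def kl \<epsilon>l)
    moreover have "(\<Sum>s<k - \<epsilon>. \<Sum>t<\<epsilon> + 1. u (k - 1 - \<epsilon> - s) * g (\<epsilon> - t) * ?m s t)
       = g (Suc l) * ?m 0 0 + (g l * ?m 0 1 + (\<Sum>t<l. g (l - Suc t) * ?m 0 (t + 2)))"
      unfolding kl \<epsilon>l by (simp add: u sum.lessThan_Suc_shift del: sum.lessThan_Suc)
    ultimately have "(\<Sum>s<k - \<epsilon>. \<Sum>t<\<epsilon> + 1. u (k - 1 - \<epsilon> - s) * g (\<epsilon> - t) * ?m s t)
       = g (Suc l) * (2 * c * p k + p (Suc l)) + (g l * (p l - p k) + (\<Sum>i<l. g i * p i))"
      by (simp only:)
    also have "\<dots> = (\<Sum>i<Suc k. p i * g i)"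
      unfolding kl by (simp add: g algebra_simps)
    finally show ?thesis .
  next
    case second
    define l where "l = k - 2"
    have kl: "k = Suc (Suc l)" using k by (auto simp: l_def)
    have gu: "g i = u i" for i using second by (simp add: u_def g_def)
    have "(\<Sum>t<l. u (l - Suc t) * p (l - Suc t)) = (\<Sum>i<l. u i * p i)"
      by (rule rev[of "\<lambda>i. u i * p i"])
    moreover have "(\<Sum>s<k - \<epsilon>. \<Sum>t<\<epsilon> + 1. u (k - 1 - \<epsilon> - s) * g (\<epsilon> - t) * ?m s t)
       = u (Suc l) * ?m 0 0 + (u l * ?m 1 0 + (\<Sum>t<l. u (l - Suc t) * ?m (t + 2) 0))"
      unfolding kl second(1) by (simp add: g sum.lessThan_Suc_shift del: sum.lessThan_Suc)
    moreover have "?m 0 0 = 2 * c * p k + p (Suc l)" "?m 1 0 = p l - p k"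
      "\<And>t. ?m (t + 2) 0 = p (l - Suc t)"
      using second by (simp_all add: chebM_scalar_def Let_def kl)
    ultimately have "(\<Sum>s<k - \<epsilon>. \<Sum>t<\<epsilon> + 1. u (k - 1 - \<epsilon> - s) * g (\<epsilon> - t) * ?m s t)
       = u (Suc l) * (2 * c * p k + p (Suc l)) + (u l * (p l - p k) + (\<Sum>i<l. u i * p i))"
      by (simp only:)
    also have "\<dots> = (\<Sum>i<Suc k. p i * g i)"
      unfolding kl gu by (simp add: u algebra_simps)
    finally show ?thesis .
  next
    case first
    define l where "l = k - 2"
    have kl: "k = Suc (Suc l)" using k by (auto simp: l_def)
    have gu: "2 * g (Suc (Suc i)) = u (Suc (Suc i)) - u i" for i
      using arg_cong[OF chebyshev_first_second[of i], of "\<lambda>q. poly q c"] first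
      unfolding u_def g_def by (simp del: chebyshev.simps(3))
    have g1: "2 * g (Suc 0) = u (Suc 0)" using first by (simp add: u_def g_def)
    \<comment> \<open>Twice the target, rewritten in second-kind polynomials; \<open>p 0\<close> and
      \<open>p 1\<close> stay apart, since \<open>chebyshev_first_second\<close> begins at index
      2.\<close>
    have rhs: "2 * (\<Sum>i<Suc k. p i * g i)
      = 2 * p 0 + p 1 * u 1 + (\<Sum>i<Suc l. p (i + 2) * u (i + 2)) - (\<Sum>i<Suc l. p (i + 2) * u i)"
    proof -
      have "2 * (\<Sum>i<Suc k. p i * g i)
        = 2 * p 0 + p 1 * (2 * g (Suc 0)) + (\<Sum>i<Suc l. p (i + 2) * (2 * g (Suc (Suc i))))"
        unfolding kl
        by (simp add: g sum.lessThan_Suc_shift sum_distrib_left algebra_simps del: sum.lessThan_Suc)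
      then show ?thesis
        unfolding gu g1 by (simp add: algebra_simps sum_subtractf del: sum.lessThan_Suc)
    qed
    have single: "(\<Sum>t<0 + 1. f t) = f 0" for f :: "nat \<Rightarrow> complex"
      by simp
    have lhs: "2 * (\<Sum>s<k - \<epsilon>. \<Sum>t<\<epsilon> + 1. u (k - 1 - \<epsilon> - s) * g (\<epsilon> - t) * ?m s t)
       = (\<Sum>s<Suc (Suc l). u (Suc l - s) * (2 * ?m s 0))"
      unfolding kl first(1) single
      by (simp add: g sum_distrib_left mult.left_commute del: sum.lessThan_Suc)
    have "(\<Sum>s<Suc (Suc l). u (Suc l - s) * (2 * ?m s 0))
      = 2 * p 0 + p 1 * u 1 + (\<Sum>i<Suc l. p (i + 2) * u (i + 2)) - (\<Sum>i<Suc l. p (i + 2) * u i)"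
    \<comment> \<open>The case \<open>l = 0\<close> is \<open>k = 2\<close>, for which
      \<open>M\<close> has a pattern of its own. For \<open>k > 2\<close> the last block, with its
      doubled \<open>p 0\<close>, is split off in addition to the first two.\<close>
    proof (cases l)
      case 0
      then show ?thesis
        using first by (simp add: chebM_scalar_def Let_def kl u algebra_simps numeral_2_eq_2)
    next
      case (Suc l')
      have "(\<Sum>s<l'. u (l' - Suc s + 1) * (p (l' - Suc s + 1) - p (l' - Suc s + 3)))
          = (\<Sum>i<l'. u (i + 1) * (p (i + 1) - p (i + 3)))"
        by (rule rev[of "\<lambda>i. u (i + 1) * (p (i + 1) - p (i + 3))"])
      moreover have "(\<Sum>s<Suc (Suc l). u (Suc l - s) * (2 * ?m s 0))
        = u (Suc l) * (2 * ?m 0 0) + (u l * (2 * ?m 1 0)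
          + ((\<Sum>s<l'. u (l' - s) * (2 * ?m (s + 2) 0)) + u 0 * (2 * ?m (l' + 2) 0)))"
        unfolding Suc by (subst sum.lessThan_Suc_shift, subst sum.lessThan_Suc_shift) simp
      moreover have "2 * ?m 0 0 = 2 * c * p k + p (Suc l)" "2 * ?m 1 0 = p l - 2 * p k"
        "2 * ?m (l' + 2) 0 = 2 * p 0 - p 2"
        using first by (simp_all add: chebM_scalar_def Let_def kl Suc)
      moreover have "(\<Sum>s<l'. u (l' - s) * (2 * ?m (s + 2) 0))
        = (\<Sum>s<l'. u (l' - Suc s + 1) * (p (l' - Suc s + 1) - p (l' - Suc s + 3)))"
      proof (intro sum.cong refl)
        fix s assume "s \<in> {..<l'}"
        then obtain q where "l' = Suc (s + q)" by (auto dest: less_imp_Suc_add)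
        then show "u (l' - s) * (2 * ?m (s + 2) 0)
          = u (l' - Suc s + 1) * (p (l' - Suc s + 1) - p (l' - Suc s + 3))"
          using first by (simp add: chebM_scalar_def Let_def kl Suc numeral_3_eq_3)
      qed
      moreover have "p 1 * u 1 + (\<Sum>i<Suc l. p (i + 2) * u (i + 2)) = (\<Sum>i<Suc (Suc l). p (i + 1) * u (i + 1))"
        by (subst (2) sum.lessThan_Suc_shift) simp
      moreover have "(\<Sum>i<Suc l. p (i + 2) * u i) = p 2 + (\<Sum>i<l. p (i + 3) * u (i + 1))"
        by (subst sum.lessThan_Suc_shift) (simp add: u numeral_3_eq_3 numeral_2_eq_2)
      ultimately have "(\<Sum>s<Suc (Suc l). u (Suc l - s) * (2 * ?m s 0))
          = u (Suc l) * (2 * c * p k + p (Suc l)) + (u l * (p l - 2 * p k)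
            + ((\<Sum>i<l'. u (i + 1) * (p (i + 1) - p (i + 3))) + u 0 * (2 * p 0 - p 2)))"
        and "2 * p 0 + p 1 * u 1 + (\<Sum>i<Suc l. p (i + 2) * u (i + 2)) - (\<Sum>i<Suc l. p (i + 2) * u i)
          = 2 * p 0 + (\<Sum>i<Suc (Suc l). p (i + 1) * u (i + 1)) - (p 2 + (\<Sum>i<l. p (i + 3) * u (i + 1)))"
        by (simp_all only: add.assoc)
      moreover have "u (Suc l) * (2 * c * p k + p (Suc l)) + (u l * (p l - 2 * p k)
            + ((\<Sum>i<l'. u (i + 1) * (p (i + 1) - p (i + 3))) + u 0 * (2 * p 0 - p 2)))
          = 2 * p 0 + (\<Sum>i<Suc (Suc l). p (i + 1) * u (i + 1)) - (p 2 + (\<Sum>i<l. p (i + 3) * u (i + 1)))"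
        unfolding Suc kl
        by (simp add: u sum_subtractf algebra_simps numeral_3_eq_3 numeral_2_eq_2)
      ultimately show ?thesis by (simp only:)
    qed
    with lhs rhs have "2 * (\<Sum>s<k - \<epsilon>. \<Sum>t<\<epsilon> + 1. u (k - 1 - \<epsilon> - s) * g (\<epsilon> - t) * ?m s t)
       = 2 * (\<Sum>i<Suc k. p i * g i)" by (simp only:)
    then show ?thesis by (simp only: mult_left_cancel[OF zero_neq_numeral[symmetric]])
  next
    case mid
    \<comment> \<open>With these, \<open>\<epsilon> = e + 1\<close> and
      \<open>k = e + d + 3\<close>, so there are \<open>d + 2\<close> block rows and
      \<open>e + 2\<close> block columns. The double sum is evaluated column by column.\<close>
    define e d where "e = \<epsilon> - 1" and "d = k - \<epsilon> - 2"
    have \<epsilon>e: "\<epsilon> = Suc e" and ke: "k = Suc (Suc (Suc (e + d)))"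
      using mid k \<epsilon> by (auto simp: e_def d_def)
    let ?w = "\<lambda>s t. u (Suc d - s) * g (Suc e - t) * ?m s t"
    \<comment> \<open>The range has \<open>d + 3\<close> terms although the column has
      \<open>d + 2\<close> blocks: the recurrence turns the factor \<open>2 lambda\<close> at
      \<open>p k\<close> into the term with \<open>i = d + 2\<close>.\<close>
    have col1: "(\<Sum>s<Suc (Suc d). ?w s 0) = g (Suc e) * (\<Sum>i<Suc (Suc (Suc d)). u i * p (Suc e + i))"
    proof -
      have "(\<Sum>s<d. u (d - Suc s) * p (Suc e + (d - Suc s))) = (\<Sum>i<d. u i * p (Suc e + i))"
        by (rule rev[of "\<lambda>i. u i * p (Suc e + i)"])
      moreover have "(\<Sum>s<Suc (Suc d). ?w s 0)
        = ?w 0 0 + (?w 1 0 + (\<Sum>s<d. ?w (s + 2) 0))"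
        by (simp add: sum.lessThan_Suc_shift del: sum.lessThan_Suc)
      moreover have "?m 0 0 = 2 * c * p k + p (k - 1)" "?m 1 0 = p (k - 2) - p k"
        by (simp_all add: chebM_scalar_def Let_def ke \<epsilon>e)
      moreover have "(\<Sum>s<d. ?w (s + 2) 0) = (\<Sum>s<d. g (Suc e) * (u (d - Suc s) * p (Suc e + (d - Suc s))))"
      proof (intro sum.cong refl)
        fix s assume "s \<in> {..<d}"
        then obtain q where "d = Suc (s + q)" by (auto dest: less_imp_Suc_add)
        then show "?w (s + 2) 0 = g (Suc e) * (u (d - Suc s) * p (Suc e + (d - Suc s)))"
          by (simp add: chebM_scalar_def Let_def ke \<epsilon>e)
      qed
      ultimately have "(\<Sum>s<Suc (Suc d). ?w s 0) = u (Suc d - 0) * g (Suc e - 0) * (2 * c * p k + p (k - 1))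
          + (u (Suc d - 1) * g (Suc e - 0) * (p (k - 2) - p k) + g (Suc e) * (\<Sum>i<d. u i * p (Suc e + i)))"
        by (simp only: sum_distrib_left[symmetric])
      also have "\<dots> = g (Suc e) * (\<Sum>i<Suc (Suc (Suc d)). u i * p (Suc e + i))"
        by (simp add: u ke algebra_simps)
      finally show ?thesis .
    qed
    \<comment> \<open>A row \<open>s \<le> d\<close>, counted from 0, contributes the summand with
      \<open>p (k - s)\<close>; the last row contributes both \<open>p e\<close> and the summand for
      \<open>i = 0\<close>.\<close>
    have col2: "(\<Sum>s<Suc (Suc d). ?w s 1) = g e * (p e - (\<Sum>i<Suc (Suc d). u i * p (e + 2 + i)))"
    proof -
      have "(\<Sum>s<Suc d. u (Suc d - Suc s + 1) * p (e + 3 + (Suc d - Suc s)))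
          = (\<Sum>i<Suc d. u (i + 1) * p (e + 3 + i))"
        by (rule rev[of "\<lambda>i. u (i + 1) * p (e + 3 + i)"])
      moreover have "(\<Sum>s<Suc d. ?w s 1)
        = (\<Sum>s<Suc d. - g e * (u (Suc d - Suc s + 1) * p (e + 3 + (Suc d - Suc s))))"
      proof (intro sum.cong refl)
        fix s assume "s \<in> {..<Suc d}"
        then obtain q where "d = s + q" by (metis lessThan_iff less_Suc_eq_le le_Suc_ex)
        then show "?w s 1 = - g e * (u (Suc d - Suc s + 1) * p (e + 3 + (Suc d - Suc s)))"
          by (simp add: chebM_scalar_def Let_def ke \<epsilon>e numeral_3_eq_3 Suc_diff_le)
      qed
      moreover have "?w (Suc d) 1 = g e * (p e - p (e + 2))"
        by (simp add: chebM_scalar_def Let_def ke \<epsilon>e u)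
      moreover have "(\<Sum>i<Suc (Suc d). u i * p (e + 2 + i)) = p (e + 2) + (\<Sum>i<Suc d. u (i + 1) * p (e + 3 + i))"
        by (subst sum.lessThan_Suc_shift) (simp add: u numeral_3_eq_3 numeral_2_eq_2)
      ultimately show ?thesis
        unfolding sum.lessThan_Suc[of _ "Suc d"]
        by (simp only: sum_distrib_left[symmetric]) (simp add: algebra_simps del: sum.lessThan_Suc)
    qed
    \<comment> \<open>Only the last row is nonzero here, and its row weight is
      \<open>U(0) = 1\<close>.\<close>
    have cols: "(\<Sum>t<e. \<Sum>s<Suc (Suc d). ?w s (t + 2)) = (\<Sum>i<e. g i * p i)"
    proof -
      have "(\<Sum>s<Suc (Suc d). ?w s (t + 2)) = g (e - Suc t) * p (e - Suc t)" for t
      proof -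
        have "(\<Sum>s<Suc d. ?w s (t + 2)) = 0"
          by (intro sum.neutral) (auto simp: chebM_scalar_def Let_def ke \<epsilon>e)
        moreover have "?w (Suc d) (t + 2) = g (e - Suc t) * p (e - Suc t)"
          by (simp add: chebM_scalar_def Let_def ke \<epsilon>e u)
        ultimately show ?thesis by (subst sum.lessThan_Suc) simp
      qed
      then show ?thesis using rev[of "\<lambda>i. g i * p i" e] by simp
    qed
    have "(\<Sum>s<k - \<epsilon>. \<Sum>t<\<epsilon> + 1. u (k - 1 - \<epsilon> - s) * g (\<epsilon> - t) * ?m s t)
      = (\<Sum>s<Suc (Suc d). \<Sum>t<Suc (Suc e). ?w s t)"
      by (simp add: ke \<epsilon>e del: sum.lessThan_Suc)
    also have "\<dots> = (\<Sum>t<Suc (Suc e). \<Sum>s<Suc (Suc d). ?w s t)"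
      by (rule sum.swap)
    also have "\<dots> = (\<Sum>s<Suc (Suc d). ?w s 0) + ((\<Sum>s<Suc (Suc d). ?w s 1)
        + (\<Sum>t<e. \<Sum>s<Suc (Suc d). ?w s (t + 2)))"
      by (subst sum.lessThan_Suc_shift, subst sum.lessThan_Suc_shift) (simp del: sum.lessThan_Suc)
    \<comment> \<open>The summand of \<open>col1\<close> with \<open>i = 0\<close> yields
      \<open>p (e + 1)\<close>. The others, shifted by one, meet those of \<open>col2\<close> at the
      same coefficient \<open>p (e + 2 + i)\<close>, in exactly the combination of
      \<open>shift\<close>.\<close>
    also have "\<dots> = (\<Sum>i<e. g i * p i) + g e * p e + g (Suc e) * p (Suc e)
        + (\<Sum>i<Suc (Suc d). (g (Suc e) * u (Suc i) - g e * u i) * p (e + 2 + i))"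
      unfolding col1 col2 cols
      by (subst sum.lessThan_Suc_shift)
        (simp add: u algebra_simps sum_subtractf sum_distrib_left numeral_2_eq_2 del: sum.lessThan_Suc)
    also have "\<dots> = (\<Sum>i<Suc k. p i * g i)"
    proof -
      have "Suc k = e + Suc (Suc (Suc (Suc d)))" by (simp add: ke)
      then have "(\<Sum>i<Suc k. p i * g i) = (\<Sum>i<e. p i * g i)
        + (p e * g e + (p (Suc e) * g (Suc e)
        + (\<Sum>i<Suc (Suc d). p (e + 2 + i) * g (Suc e + Suc i))))"
        by (simp only: sum_lessThan_add)
          (simp add: sum.lessThan_Suc_shift numeral_2_eq_2 del: sum.lessThan_Suc)
      then show ?thesis unfolding shift by (simp add: mult.commute del: sum.lessThan_Suc)
    qed
    finally show ?thesis .
  qed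
  then show ?thesis
    unfolding u_def g_def lessThan_Suc_atMost .
qed

lemma sum_corner:
  fixes h :: "nat \<Rightarrow> nat \<Rightarrow> 'a::comm_semiring_1"
  assumes "0 < a" "0 < b"
  shows "(\<Sum>s<a. \<Sum>t<b. (if s = 0 then 1 else 0) * (if t = 0 then 1 else 0) * h s t) = h 0 0"
proof -
  have "(\<Sum>t<b. (if s = 0 then 1 else 0) * (if t = 0 then 1 else 0) * h s t)
      = (\<Sum>t<b. if t = 0 then (if s = 0 then h 0 0 else 0) else 0)" for s
    by (intro sum.cong) auto
  then show ?thesis using assms by simp
qed

text \<open>\<open>\<kappa>\<close> is obtained before \<open>p\<close>, so that one constant serves
  all positions inside a block. At a finite point it is 1. At infinity the weights pick out the top
  left entry, and \<open>\<kappa>\<close> compares its coefficient in degree 1 with the top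
  coefficient of \<open>chebyshev r k\<close>.\<close>

lemma chebM_scalar_weighted_sum:
  assumes k: "k \<ge> 2" and r: "r \<in> {1, 2}" and \<epsilon>: "\<epsilon> \<le> k - 1"
  obtains \<kappa> where "\<kappa> \<noteq> 0"
    "\<And>p. (\<Sum>s<k - \<epsilon>. \<Sum>t<\<epsilon> + 1. cheb_weight lam 2 (k - 1 - \<epsilon>) s * cheb_weight lam r \<epsilon> t
            * lam_val 1 lam (chebM_scalar k r \<epsilon> p (s + 1) (t + 1)))
       = \<kappa> * lam_val k lam (\<Sum>i\<le>k. smult (p i) (chebyshev r i))"
proof (cases lam)
  case (Finite c)
  show ?thesis
    by (rule that[of 1])
      (use chebM_scalar_sum[OF assms] in \<open>simp_all add: Finite poly_sum\<close>)
next
  case Infinite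
  \<comment> \<open>The factor of \<open>p k\<close> in the top left entry: 2 from
    \<open>2 lambda\<close>, halved when \<open>M\<close> carries the factor
    \<open>1/2\<close>.\<close>
  let ?a = "if \<epsilon> = 0 \<and> r = 1 then 1 else 2 :: complex"
  have top: "coeff (chebM_scalar k r \<epsilon> p 1 1) 1 = ?a * p k" for p
    using k by (auto simp: chebM_scalar_def Let_def)
  have "(\<Sum>s<k - \<epsilon>. \<Sum>t<\<epsilon> + 1. cheb_weight lam 2 (k - 1 - \<epsilon>) s * cheb_weight lam r \<epsilon> t
            * lam_val 1 lam (chebM_scalar k r \<epsilon> p (s + 1) (t + 1))) = ?a * p k" for p
    using k \<epsilon> top[of p] unfolding Infinite cheb_weight.simps
    by (subst sum_corner) (simp_all del: One_nat_def)
  moreover have "coeff (\<Sum>i\<le>k. smult (p i) (chebyshev r i)) k = p k * coeff (chebyshev r k) k" for p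
  proof -
    have "coeff (\<Sum>i\<le>k. smult (p i) (chebyshev r i)) k
        = (\<Sum>i\<le>k. if i = k then p k * coeff (chebyshev r k) k else 0)"
      unfolding coeff_sum by (intro sum.cong) (auto simp: coeff_chebyshev_above)
    then show ?thesis by simp
  qed
  ultimately show ?thesis
    using coeff_chebyshev_top[of r k] Infinite
    by (intro that[of "?a / coeff (chebyshev r k) k"]) (simp_all add: field_simps)
qed

text \<open>\<open>kron_sandwich_index\<close> turns the claim into one scalar identity for each
  position \<open>(i, j)\<close>, with \<open>p l\<close> the entry of \<open>P l\<close>
  there.\<close>

lemma chebM_sandwich:
  assumes k: "k \<ge> 2" and r: "r \<in> {1, 2}" and \<epsilon>: "\<epsilon> \<le> k - 1"
    and P: "\<And>i. i \<le> k \<Longrightarrow> P i \<in> carrier_mat n n"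
  obtains \<kappa> where "\<kappa> \<noteq> 0"
    "transpose_mat (kron_col n (k - \<epsilon>) (cheb_weight lam 2 (k - 1 - \<epsilon>)))
        * map_mat (lam_val 1 lam) (chebM n k r \<epsilon> P) * kron_col n (\<epsilon> + 1) (cheb_weight lam r \<epsilon>)
      = \<kappa> \<cdot>\<^sub>m map_mat (lam_val k lam) (cheb_mp n k r P)"
proof -
  obtain \<kappa> where \<kappa>: "\<kappa> \<noteq> 0"
    "\<And>p. (\<Sum>s<k - \<epsilon>. \<Sum>t<\<epsilon> + 1. cheb_weight lam 2 (k - 1 - \<epsilon>) s * cheb_weight lam r \<epsilon> t
            * lam_val 1 lam (chebM_scalar k r \<epsilon> p (s + 1) (t + 1)))
       = \<kappa> * lam_val k lam (\<Sum>i\<le>k. smult (p i) (chebyshev r i))"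
    using chebM_scalar_weighted_sum[OF k r \<epsilon>, of lam] by blast
  let ?M = "map_mat (lam_val 1 lam) (chebM n k r \<epsilon> P)"
  have Mc: "chebM n k r \<epsilon> P \<in> carrier_mat ((k - \<epsilon>) * n) ((\<epsilon> + 1) * n)"
    by (rule chebM_carrier[OF \<epsilon> k])
  then have M: "?M \<in> carrier_mat ((k - \<epsilon>) * n) ((\<epsilon> + 1) * n)" by simp
  have "transpose_mat (kron_col n (k - \<epsilon>) (cheb_weight lam 2 (k - 1 - \<epsilon>)))
        * ?M * kron_col n (\<epsilon> + 1) (cheb_weight lam r \<epsilon>)
      = \<kappa> \<cdot>\<^sub>m map_mat (lam_val k lam) (cheb_mp n k r P)" (is "?L = ?R")
  proof (rule eq_matI)
    fix i j assume "i < dim_row ?R" "j < dim_col ?R"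
    then have ij: "i < n" "j < n" by (simp_all add: cheb_mp_def)
    have "?M $$ (s * n + i, t * n + j)
        = lam_val 1 lam (chebM_scalar k r \<epsilon> (\<lambda>l. P l $$ (i, j)) (s + 1) (t + 1))"
      if "s < k - \<epsilon>" "t < \<epsilon> + 1" for s t
      using Mc chebM_index[OF k \<epsilon> P that ij] block_index_less[OF that(1) ij(1)]
        block_index_less[OF that(2) ij(2)]
      by (subst index_map_mat) (simp_all del: One_nat_def)
    then have "?L $$ (i, j) = (\<Sum>s<k - \<epsilon>. \<Sum>t<\<epsilon> + 1. cheb_weight lam 2 (k - 1 - \<epsilon>) s
        * cheb_weight lam r \<epsilon> t
        * lam_val 1 lam (chebM_scalar k r \<epsilon> (\<lambda>l. P l $$ (i, j)) (s + 1) (t + 1)))"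
      unfolding kron_sandwich_index[OF M ij] by (intro sum.cong refl) simp
    also have "\<dots> = ?R $$ (i, j)"
      unfolding \<kappa>(2) using ij by (simp add: cheb_mp_def)
    finally show "?L $$ (i, j) = ?R $$ (i, j)" .
  qed (simp_all add: cheb_mp_def)
  with \<kappa>(1) show ?thesis by (rule that)
qed

section \<open>Eigenvectors of \<open>C\<close>\<close>

lemma map_lam_val_chebC:
  fixes k n r \<epsilon> :: nat and lam :: eigval
  defines "K \<equiv> map_mat (lam_val 1 lam) (chebK n r \<epsilon>)"
    and "L \<equiv> map_mat (lam_val 1 lam) (chebK n 2 (k - 1 - \<epsilon>))"
  assumes k: "k \<ge> 2" and \<epsilon>: "\<epsilon> \<le> k - 1"
    and A: "A \<in> carrier_mat ((k - \<epsilon>) * n) (\<epsilon> * n)"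
    and B: "B \<in> carrier_mat ((k - 1 - \<epsilon>) * n) ((\<epsilon> + 1) * n)"
  shows "map_mat (lam_val 1 lam) (chebC n k r \<epsilon> P A B)
    = four_block_mat (map_mat (lam_val 1 lam) (chebM n k r \<epsilon> P) + A * K + transpose_mat L * B)
        (transpose_mat L) K (0\<^sub>m (\<epsilon> * n) ((k - 1 - \<epsilon>) * n))"
proof -
  let ?d = "k - 1 - \<epsilon>"
  let ?K = "chebK n r \<epsilon>" and ?L = "transpose_mat (chebK n 2 ?d)" and ?M = "chebM n k r \<epsilon> P"
  have d: "?d + 1 = k - \<epsilon>" using k \<epsilon> by simp
  have K: "?K \<in> carrier_mat (\<epsilon> * n) ((\<epsilon> + 1) * n)"
    by (rule carrier_matI) simp_all
  have "chebK n 2 ?d \<in> carrier_mat (?d * n) ((?d + 1) * n)"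
    by (rule carrier_matI) (simp_all only: chebK_dims)
  then have L: "?L \<in> carrier_mat ((k - \<epsilon>) * n) (?d * n)"
    unfolding d by (simp only: transpose_carrier_mat)
  have M: "?M \<in> carrier_mat ((k - \<epsilon>) * n) ((\<epsilon> + 1) * n)"
    by (rule chebM_carrier[OF \<epsilon> k])
  have AK: "const_mp A * ?K \<in> carrier_mat ((k - \<epsilon>) * n) ((\<epsilon> + 1) * n)"
    using A by (intro mult_carrier_mat[OF _ K]) (simp add: const_mp_def)
  have LB: "?L * const_mp B \<in> carrier_mat ((k - \<epsilon>) * n) ((\<epsilon> + 1) * n)"
    using B by (intro mult_carrier_mat[OF L]) (simp add: const_mp_def)
  have T: "?M + const_mp A * ?K + ?L * const_mp B \<in> carrier_mat ((k - \<epsilon>) * n) ((\<epsilon> + 1) * n)"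
    using M AK LB by (intro add_carrier_mat)
  have "map_mat (lam_val 1 lam) (?M + const_mp A * ?K + ?L * const_mp B)
      = map_mat (lam_val 1 lam) ?M + A * K + transpose_mat L * B"
    unfolding K_def L_def map_transpose[symmetric]
    using map_lam_val_add[OF add_carrier_mat[OF AK, of ?M] LB, of 1 lam] map_lam_val_add[OF M AK, of 1 lam]
      map_lam_val_const_left[OF A K, of 1 lam] map_lam_val_const_right[OF L B, of 1 lam] M
    by (simp only:)
  moreover have "map_mat (lam_val 1 lam) (0\<^sub>m (\<epsilon> * n) (?d * n)) = 0\<^sub>m (\<epsilon> * n) (?d * n)"
    by (intro eq_matI) simp_all
  ultimately show ?thesis
    unfolding chebC_def Let_def map_four_block_mat[OF T L K zero_carrier_mat]
    by (simp only: K_def L_def map_transpose)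
qed

lemma vec_block_vec_first:
  assumes "i * n \<le> b" "i \<ge> 1"
  shows "vec_block n (vec_first z b) i = vec_block n z i"
proof (rule eq_vecI)
  fix j assume "j < dim_vec (vec_block n z i)"
  then have j: "j < n" by (simp add: vec_block_def)
  obtain l where "i = Suc l" using assms(2) by (cases i) auto
  then have "(i - 1) * n + j < b" using assms(1) j by simp
  then show "vec_block n (vec_first z b) i $ j = vec_block n z i $ j"
    using j by (simp add: vec_block_def vec_first_def)
qed (simp add: vec_block_def)

lemma smult_mat_mult_vec_eq_0:
  fixes X :: "'a::field mat"
  assumes X: "X \<in> carrier_mat a b" and x: "x \<in> carrier_vec b"
    and "\<kappa> \<noteq> 0" and "(\<kappa> \<cdot>\<^sub>m X) *\<^sub>v x = 0\<^sub>v a"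
  shows "X *\<^sub>v x = 0\<^sub>v a"
proof (rule eq_vecI)
  fix i assume "i < dim_vec (0\<^sub>v a :: 'a vec)"
  then have i: "i < a" by simp
  have "\<kappa> * (X *\<^sub>v x) $ i = ((\<kappa> \<cdot>\<^sub>m X) *\<^sub>v x) $ i"
    using X x i by (simp add: scalar_prod_def sum_distrib_left mult.assoc)
  then show "(X *\<^sub>v x) $ i = 0\<^sub>v a $ i"
    using assms(3,4) i by simp
qed (use X in simp)

lemma transpose_smult_mat: "transpose_mat (\<kappa> \<cdot>\<^sub>m X) = \<kappa> \<cdot>\<^sub>m transpose_mat X"
  by (intro eq_matI) simp_all

text \<open>\<open>block_kernel_vector\<close> is applied to the image of \<open>C\<close> under
  \<open>lam_val\<close>. For left eigenvectors the transposed image has the same shape, with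
  \<open>K\<close> and \<open>L\<close>, \<open>N1\<close> and \<open>N2\<close>, and the transposes
  of \<open>A\<close> and \<open>B\<close> exchanged.\<close>

lemma chebC_eigenvectors:
  assumes k: "k \<ge> 2" and r: "r \<in> {1, 2}" and \<epsilon>: "\<epsilon> \<le> k - 1"
    and P: "\<And>i. i \<le> k \<Longrightarrow> P i \<in> carrier_mat n n"
    and A: "A \<in> carrier_mat ((k - \<epsilon>) * n) (\<epsilon> * n)"
    and B: "B \<in> carrier_mat ((k - 1 - \<epsilon>) * n) ((\<epsilon> + 1) * n)"
  shows chebC_right_eigenvector: "right_eigenvector 1 (chebC n k r \<epsilon> P A B) lam z \<Longrightarrow>
      right_eigenvector k (cheb_mp n k r P) lam (vec_block n z (cheb_pivot lam \<epsilon> + 1))"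
    and chebC_left_eigenvector: "left_eigenvector 1 (chebC n k r \<epsilon> P A B) lam w \<Longrightarrow>
      left_eigenvector k (cheb_mp n k r P) lam (vec_block n w (cheb_pivot lam (k - 1 - \<epsilon>) + 1))"
proof -
  define d where "d = k - 1 - \<epsilon>"
  have d: "k - \<epsilon> = d + 1" "k - 1 - \<epsilon> = d" using k \<epsilon> by (auto simp: d_def)
  define K L M X where "K = map_mat (lam_val 1 lam) (chebK n r \<epsilon>)"
    and "L = map_mat (lam_val 1 lam) (chebK n 2 d)"
    and "M = map_mat (lam_val 1 lam) (chebM n k r \<epsilon> P)"
    and "X = map_mat (lam_val k lam) (cheb_mp n k r P)"
  define N1 N2 where "N1 = kron_col n (\<epsilon> + 1) (cheb_weight lam r \<epsilon>)"
    and "N2 = kron_col n (d + 1) (cheb_weight lam 2 d)"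
  let ?b = "(\<epsilon> + 1) * n" and ?a = "(d + 1) * n" and ?q = "\<epsilon> * n" and ?p = "d * n"
  let ?T = "M + A * K + transpose_mat L * B"
  have K: "K \<in> carrier_mat ?q ?b" and L: "L \<in> carrier_mat ?p ?a"
    unfolding K_def L_def map_carrier_mat by (rule carrier_matI; simp)+
  have M: "M \<in> carrier_mat ?a ?b"
    using chebM_carrier[OF \<epsilon> k, of n r P] unfolding M_def d by (simp only: map_carrier_mat)
  have A: "A \<in> carrier_mat ?a ?q" and B: "B \<in> carrier_mat ?p ?b"
    using A B unfolding d by simp_all
  have N1: "N1 \<in> carrier_mat ?b n" and N2: "N2 \<in> carrier_mat ?a n"
    unfolding N1_def N2_def by (rule kron_col_carrier)+
  have X: "X \<in> carrier_mat n n" by (simp add: X_def cheb_mp_def)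
  have LT: "transpose_mat L \<in> carrier_mat ?a ?p" using L by (simp only: transpose_carrier_mat)
  have T: "?T \<in> carrier_mat ?a ?b"
    by (intro add_carrier_mat mult_carrier_mat[OF LT B])
  have C: "map_mat (lam_val 1 lam) (chebC n k r \<epsilon> P A B)
      = four_block_mat ?T (transpose_mat L) K (0\<^sub>m ?q ?p)"
    using map_lam_val_chebC[OF k \<epsilon>, where n = n and A = A and B = B and lam = lam and r = r and P = P] A B
    unfolding d K_def L_def M_def by blast
  \<comment> \<open>\<open>map_mat\<close> preserves dimensions, so they can be read off the
    image.\<close>
  have Cdims: "dim_row (chebC n k r \<epsilon> P A B) = ?a + ?q" "dim_col (chebC n k r \<epsilon> P A B) = ?b + ?p"
  proof -
    have "four_block_mat ?T (transpose_mat L) K (0\<^sub>m ?q ?p) \<in> carrier_mat (?a + ?q) (?b + ?p)"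
      by (rule four_block_carrier_mat[OF T zero_carrier_mat])
    then show "dim_row (chebC n k r \<epsilon> P A B) = ?a + ?q" "dim_col (chebC n k r \<epsilon> P A B) = ?b + ?p"
      unfolding C[symmetric] by (auto dest: carrier_matD)
  qed
  have Pdims: "dim_row (cheb_mp n k r P) = n" "dim_col (cheb_mp n k r P) = n"
    by (simp_all add: cheb_mp_def)
  obtain \<kappa> where \<kappa>: "\<kappa> \<noteq> 0" and S: "transpose_mat N2 * M * N1 = \<kappa> \<cdot>\<^sub>m X"
    using chebM_sandwich[where lam = lam and n = n and P = P, OF k r \<epsilon> P] unfolding d N1_def N2_def M_def X_def by metis
  have ST: "transpose_mat N1 * transpose_mat M * N2 = \<kappa> \<cdot>\<^sub>m transpose_mat X"
  proof -
    have N2T: "transpose_mat N2 \<in> carrier_mat n ?a" and N1T: "transpose_mat N1 \<in> carrier_mat n ?b"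
      and MT: "transpose_mat M \<in> carrier_mat ?b ?a"
      using N2 N1 M by (simp_all only: transpose_carrier_mat)
    have "transpose_mat (transpose_mat N2 * M * N1) = transpose_mat N1 * (transpose_mat M * N2)"
      using transpose_mult[OF mult_carrier_mat[OF N2T M] N1] transpose_mult[OF N2T M]
      by (simp only: transpose_transpose)
    also have "\<dots> = transpose_mat N1 * transpose_mat M * N2"
      by (rule assoc_mult_mat[OF N1T MT N2, symmetric])
    finally show ?thesis unfolding S transpose_smult_mat by (rule sym)
  qed
  have block: "vec_block n v i \<in> carrier_vec n" for v :: "complex vec" and i
    by (simp add: vec_block_def)
  have first: "vec_block n (vec_first z ((m + 1) * n)) (cheb_pivot lam m + 1) = vec_block n z (cheb_pivot lam m + 1)"
    for z :: "complex vec" and m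
    using cheb_pivot_le[of lam m] by (intro vec_block_vec_first) (auto intro!: mult_le_mono1)
  show "right_eigenvector k (cheb_mp n k r P) lam (vec_block n z (cheb_pivot lam \<epsilon> + 1))"
    if z: "right_eigenvector 1 (chebC n k r \<epsilon> P A B) lam z"
  proof -
    have z1: "z \<in> carrier_vec (?b + ?p)" and z2: "z \<noteq> 0\<^sub>v (?b + ?p)"
      and z3: "four_block_mat ?T (transpose_mat L) K (0\<^sub>m ?q ?p) *\<^sub>v z = 0\<^sub>v (?a + ?q)"
      using z unfolding right_eigenvector_iff C Cdims by blast+
    have ker: "v = N1 *\<^sub>v vec_block n v (cheb_pivot lam \<epsilon> + 1)"
      if "v \<in> carrier_vec ?b" "K *\<^sub>v v = 0\<^sub>v ?q" for v
      using chebK_kernel that unfolding K_def N1_def by blast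
    have inj: "u = 0\<^sub>v ?p" if "u \<in> carrier_vec ?p" "transpose_mat L *\<^sub>v u = 0\<^sub>v ?a" for u
      using chebK_transpose_injective that unfolding L_def by blast
    have LN: "L * N2 = 0\<^sub>m ?p n"
      unfolding L_def N2_def by (rule chebK_mult_kron_col)
    note kernel = block_kernel_vector[OF M A K L B N1 N2 z1 z2 z3 block ker LN inj, unfolded first S]
    show ?thesis
      unfolding right_eigenvector_iff Pdims X_def[symmetric]
      using kernel smult_mat_mult_vec_eq_0[OF X block \<kappa>] block by blast
  qed
  show "left_eigenvector k (cheb_mp n k r P) lam (vec_block n w (cheb_pivot lam (k - 1 - \<epsilon>) + 1))"
    if w: "left_eigenvector 1 (chebC n k r \<epsilon> P A B) lam w"
  proof -
    have AT: "transpose_mat A \<in> carrier_mat ?q ?a" and BT: "transpose_mat B \<in> carrier_mat ?b ?p"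
      and MT: "transpose_mat M \<in> carrier_mat ?b ?a" and KT: "transpose_mat K \<in> carrier_mat ?b ?q"
      using A B M K by (simp_all only: transpose_carrier_mat)
    have "transpose_mat ?T = transpose_mat M + transpose_mat K * transpose_mat A + transpose_mat B * L"
      using transpose_add[OF add_carrier_mat[OF mult_carrier_mat[OF A K], of M] mult_carrier_mat[OF LT B]]
        transpose_add[OF M mult_carrier_mat[OF A K]] transpose_mult[OF A K] transpose_mult[OF LT B]
      by (simp only: transpose_transpose)
    \<comment> \<open>The summands are reordered to fit the pattern
      \<open>M + A * K + L^T * B\<close>, where \<open>L\<close> now acts as
      \<open>K\<close>.\<close>
    also have "\<dots> = transpose_mat M + transpose_mat B * L + transpose_mat K * transpose_mat A"
      using MT mult_carrier_mat[OF KT AT] mult_carrier_mat[OF BT L]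
      by (metis assoc_add_mat comm_add_mat)
    finally have TT: "transpose_mat ?T
      = transpose_mat M + transpose_mat B * L + transpose_mat K * transpose_mat A" .
    have CT: "transpose_mat (four_block_mat ?T (transpose_mat L) K (0\<^sub>m ?q ?p))
      = four_block_mat (transpose_mat M + transpose_mat B * L + transpose_mat K * transpose_mat A)
          (transpose_mat K) L (0\<^sub>m ?p ?q)"
      unfolding transpose_four_block_mat[OF T LT K zero_carrier_mat] TT by simp
    have w1: "w \<in> carrier_vec (?a + ?q)" and w2: "w \<noteq> 0\<^sub>v (?a + ?q)"
      and w3: "four_block_mat (transpose_mat M + transpose_mat B * L + transpose_mat K * transpose_mat A)
          (transpose_mat K) L (0\<^sub>m ?p ?q) *\<^sub>v w = 0\<^sub>v (?b + ?p)"
      using w unfolding left_eigenvector_iff C Cdims CT by blast+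
    have ker: "v = N2 *\<^sub>v vec_block n v (cheb_pivot lam d + 1)"
      if "v \<in> carrier_vec ?a" "L *\<^sub>v v = 0\<^sub>v ?p" for v
      using chebK_kernel that unfolding L_def N2_def by blast
    have inj: "u = 0\<^sub>v ?q" if "u \<in> carrier_vec ?q" "transpose_mat K *\<^sub>v u = 0\<^sub>v ?b" for u
      using chebK_transpose_injective that unfolding K_def by blast
    have KN: "K * N1 = 0\<^sub>m ?q n"
      unfolding K_def N1_def by (rule chebK_mult_kron_col)
    note kernel = block_kernel_vector[OF MT BT L K AT N2 N1 w1 w2 w3 block ker KN inj, unfolded first ST]
    have XT: "transpose_mat X \<in> carrier_mat n n" using X by simp
    show ?thesis
      unfolding left_eigenvector_iff Pdims X_def[symmetric] d
      using kernel smult_mat_mult_vec_eq_0[OF XT block \<kappa>] block by blast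
  qed
qed

theorem theorem5p13:
  fixes n k r \<epsilon> :: nat
    and P :: "nat \<Rightarrow> complex mat"
    and A B :: "complex mat"
    and lam :: eigval
    and z w :: "complex vec"
  assumes "n \<ge> 1" and "k \<ge> 2" and "r \<in> {1, 2}" and "\<epsilon> \<le> k - 1"
    and "\<And>i. i \<le> k \<Longrightarrow> P i \<in> carrier_mat n n"
    and "regular_mp (cheb_mp n k r P)"
    and "mp_eigenvalue k (cheb_mp n k r P) lam"
    and "A \<in> carrier_mat ((k - \<epsilon>) * n) (\<epsilon> * n)"
    and "B \<in> carrier_mat ((k - 1 - \<epsilon>) * n) ((\<epsilon> + 1) * n)"
    and "right_eigenvector 1 (chebC n k r \<epsilon> P A B) lam z"
    and "left_eigenvector 1 (chebC n k r \<epsilon> P A B) lam w"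
  shows "(\<forall>c. lam = Finite c \<longrightarrow>
            right_eigenvector k (cheb_mp n k r P) (Finite c) (vec_block n z (\<epsilon> + 1)) \<and>
            left_eigenvector k (cheb_mp n k r P) (Finite c) (vec_block n w (k - \<epsilon>))) \<and>
         (lam = Infinite \<longrightarrow>
            right_eigenvector k (cheb_mp n k r P) Infinite (vec_block n z 1) \<and>
            left_eigenvector k (cheb_mp n k r P) Infinite (vec_block n w 1))"
  \<comment> \<open>At a finite point the pivots are the last blocks \<open>\<epsilon>\<close> and
    \<open>k - 1 - \<epsilon>\<close>, giving the positions \<open>\<epsilon> + 1\<close> and
    \<open>k - \<epsilon>\<close>; at infinity both pivots are 0, giving position 1.\<close>
  using chebC_right_eigenvector[OF assms(2,3,4,5,8,9,10)] chebC_left_eigenvector[OF assms(2,3,4,5,8,9,11)]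
    assms(2,4) by (cases lam) (auto simp: Suc_diff_Suc)

end
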